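(* Let $k$ be a field and let $D$ be a finite dimensional $k$-division algebra. Let $H$ be either the multiplicative group $D^{\times}$ of $D$ or the norm-1 group $\mathrm{SL}_1(D)$ of $D$. Then $H$ admits no non-trivial split spherical $BN$-pairs; that is, every split spherical $BN$-pair $(B,N)$ of $H$ satisfies $B=H$.
   Context: $\mathrm{SL}_1(D)$ denotes the group of elements of $D^\times$ of reduced norm $1$. A $BN$-pair of a group $H$ is a pair of subgroups $(B,N)$ generating $H$ such that $T:=B\cap N$ is normal in $N$ and $W:=N/T$ admits a generating set $S$ with, for all $s\in S$, $w\in W$: (BN1) $sBw\subseteq BswB\cup BwB$, and (BN2) $sBs^{-1}\not\leq B$. (Then $(W,S)$ is a Coxeter system, called the type of the $BN$-pair.) The $BN$-pair is spherical if $W$ is finite. It is saturated if $B\cap N=\bigcap_{w\in W}wBw^{-1}$. It is split if it is saturated and $B=U\rtimes T$ for some nilpotent subgroup $U$ (normal in $B$). It is trivial if $B=H$. *)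

theory Defs
  imports
    "HOL-Algebra.Generated_Groups"
    "HOL-Algebra.Algebraic_Closure_Type"
    "Jordan_Normal_Form.Determinant"
begin

section \<open>Nilpotent groups and BN-pairs\<close>

fun lower_central :: "('a, 'b) monoid_scheme \<Rightarrow> nat \<Rightarrow> 'a set" where
  "lower_central G 0 = carrier G"
| "lower_central G (Suc i) = generate G
     {x \<otimes>\<^bsub>G\<^esub> y \<otimes>\<^bsub>G\<^esub> inv\<^bsub>G\<^esub> x \<otimes>\<^bsub>G\<^esub> inv\<^bsub>G\<^esub> y | x y. x \<in> carrier G \<and> y \<in> lower_central G i}"

definition nilpotent_group :: "('a, 'b) monoid_scheme \<Rightarrow> bool" where
  "nilpotent_group G \<longleftrightarrow> group G \<and> (\<exists>i. lower_central G i = {\<one>\<^bsub>G\<^esub>})"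

definition weyl_group :: "('a, 'b) monoid_scheme \<Rightarrow> 'a set \<Rightarrow> 'a set \<Rightarrow> 'a set monoid" where
  "weyl_group G B N = (G\<lparr>carrier := N\<rparr>) Mod (B \<inter> N)"

text \<open>
  The elements of \<open>weyl_group G B N\<close> are cosets of \<open>T = B \<inter> N\<close>, that is, subsets of \<open>G\<close>.
  Because \<open>T \<subseteq> B\<close> and \<open>T\<close> is normal in \<open>N\<close>, the set products below equal the products
  formed with any choice of representatives: \<open>s B w\<close>, \<open>B s w B\<close>, \<open>w B w\<^sup>-\<^sup>1\<close>.
\<close>

definition BN_pair :: "('a, 'b) monoid_scheme \<Rightarrow> 'a set \<Rightarrow> 'a set \<Rightarrow> bool" where
  "BN_pair G B N \<longleftrightarrow>
     group G \<and> subgroup B G \<and> subgroup N G \<and> generate G (B \<union> N) = carrier G \<and>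
     B \<inter> N \<lhd> G\<lparr>carrier := N\<rparr> \<and>
     (\<exists>S \<subseteq> carrier (weyl_group G B N).
        generate (weyl_group G B N) S = carrier (weyl_group G B N) \<and>
        (\<forall>s\<in>S. \<forall>w\<in>carrier (weyl_group G B N).
           s <#>\<^bsub>G\<^esub> B <#>\<^bsub>G\<^esub> w
             \<subseteq> (B <#>\<^bsub>G\<^esub> (s \<otimes>\<^bsub>weyl_group G B N\<^esub> w) <#>\<^bsub>G\<^esub> B) \<union> (B <#>\<^bsub>G\<^esub> w <#>\<^bsub>G\<^esub> B)) \<and>
        (\<forall>s\<in>S. \<not> s <#>\<^bsub>G\<^esub> B <#>\<^bsub>G\<^esub> set_inv\<^bsub>G\<^esub> s \<subseteq> B))"

definition spherical_BN_pair :: "('a, 'b) monoid_scheme \<Rightarrow> 'a set \<Rightarrow> 'a set \<Rightarrow> bool" where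
  "spherical_BN_pair G B N \<longleftrightarrow> BN_pair G B N \<and> finite (carrier (weyl_group G B N))"

definition saturated_BN_pair :: "('a, 'b) monoid_scheme \<Rightarrow> 'a set \<Rightarrow> 'a set \<Rightarrow> bool" where
  "saturated_BN_pair G B N \<longleftrightarrow> BN_pair G B N \<and>
     B \<inter> N = (\<Inter>w\<in>carrier (weyl_group G B N). w <#>\<^bsub>G\<^esub> B <#>\<^bsub>G\<^esub> set_inv\<^bsub>G\<^esub> w)"

definition split_BN_pair :: "('a, 'b) monoid_scheme \<Rightarrow> 'a set \<Rightarrow> 'a set \<Rightarrow> bool" where
  "split_BN_pair G B N \<longleftrightarrow> saturated_BN_pair G B N \<and>
     (\<exists>U. U \<lhd> G\<lparr>carrier := B\<rparr> \<and> nilpotent_group (G\<lparr>carrier := U\<rparr>) \<and>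
          U \<inter> (B \<inter> N) = {\<one>\<^bsub>G\<^esub>} \<and> U <#>\<^bsub>G\<^esub> (B \<inter> N) = B)"


section \<open>Division algebras and the reduced norm\<close>

locale fin_dim_division_algebra = vector_space scale
  for scale :: "'k::field \<Rightarrow> 'd::division_ring \<Rightarrow> 'd" +
  assumes scale_mult_left: "scale a x * y = scale a (x * y)"
    and scale_mult_right: "x * scale a y = scale a (x * y)"
    and finite_dim: "\<exists>F. finite F \<and> span F = UNIV"

definition ring_center :: "'d::division_ring set" where
  "ring_center = {z. \<forall>x. z * x = x * z}"

text \<open>
  \<open>D\<close> need not be central over \<open>k\<close>, so the reduced norm is taken over the center \<open>Z\<close> of \<open>D\<close>.
  The algebraic closure \<open>E\<close> of \<open>k\<close> becomes an extension field of \<open>Z\<close> through a \<open>k\<close>-embedding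
  \<open>\<iota>\<close>. The map \<open>\<phi>\<close> is the restriction to \<open>D\<close> of an isomorphism from the tensor product of
  \<open>D\<close> and \<open>E\<close> over \<open>Z\<close> to the matrix algebra \<open>M\<^sub>n(E)\<close>; bijectivity of the \<open>E\<close>-linear extension
  of \<open>\<phi>\<close> is expressed by saying that \<open>\<phi>\<close> carries a \<open>Z\<close>-basis of \<open>D\<close> to an \<open>E\<close>-basis of \<open>M\<^sub>n(E)\<close>.
\<close>

definition splitting ::
  "('k::field \<Rightarrow> 'd::division_ring \<Rightarrow> 'd) \<Rightarrow> nat \<Rightarrow> ('d \<Rightarrow> 'k alg_closure) \<Rightarrow>
     ('d \<Rightarrow> 'k alg_closure mat) \<Rightarrow> bool" where
  "splitting scale n \<iota> \<phi> \<longleftrightarrow>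
     (\<forall>x. \<phi> x \<in> carrier_mat n n) \<and>
     \<phi> 1 = 1\<^sub>m n \<and> (\<forall>x y. \<phi> (x + y) = \<phi> x + \<phi> y) \<and> (\<forall>x y. \<phi> (x * y) = \<phi> x * \<phi> y) \<and>
     (\<forall>a. \<iota> (scale a 1) = to_ac a) \<and> (\<forall>z\<in>ring_center. \<phi> z = \<iota> z \<cdot>\<^sub>m 1\<^sub>m n) \<and>
     (\<exists>Y. finite Y \<and>
        (\<forall>x. \<exists>!c. c \<in> Y \<rightarrow>\<^sub>E ring_center \<and> x = (\<Sum>b\<in>Y. c b * b)) \<and>
        (\<forall>M \<in> carrier_mat n n. \<exists>!c. c \<in> Y \<rightarrow>\<^sub>E UNIV \<and>
           (\<forall>i<n. \<forall>j<n. M $$ (i, j) = (\<Sum>b\<in>Y. c b * \<phi> b $$ (i, j)))))"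

text \<open>
  Over the algebraically closed field \<open>E\<close> every embedding \<open>\<iota>\<close> admits a splitting. By the
  Skolem-Noether theorem, and since any two embeddings \<open>\<iota>\<close> differ by an automorphism of \<open>E\<close>,
  the element \<open>z\<close> of the center does not depend on the splitting.
\<close>

definition is_reduced_norm ::
  "('k::field \<Rightarrow> 'd::division_ring \<Rightarrow> 'd) \<Rightarrow> 'd \<Rightarrow> 'd \<Rightarrow> bool" where
  "is_reduced_norm scale x z \<longleftrightarrow>
     z \<in> ring_center \<and> (\<forall>n \<iota> \<phi>. splitting scale n \<iota> \<phi> \<longrightarrow> det (\<phi> x) = \<iota> z)"

definition mult_group :: "'d::division_ring monoid" where
  "mult_group = \<lparr>carrier = UNIV - {0}, monoid.mult = (*), one = 1\<rparr>"

definition SL1 :: "('k::field \<Rightarrow> 'd::division_ring \<Rightarrow> 'd) \<Rightarrow> 'd monoid" where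
  "SL1 scale = mult_group\<lparr>carrier := {x. x \<noteq> 0 \<and> is_reduced_norm scale x 1}\<rparr>"

end

theory Submission
  imports Defs "Jordan_Normal_Form.Char_Poly"
begin

text \<open>
  Let \<open>a\<close> be a central element of the nilpotent group \<open>U\<close>. Its \<open>B\<close>-conjugates commute with each other
  and are roots of a common polynomial over \<open>k\<close>, so there are finitely many of them. By the Bruhat
  decomposition \<open>H\<close> is a finite union of double cosets of \<open>B\<close>, and therefore the norm of
  \<open>a - g a g\<^sup>-\<^sup>1\<close> takes finitely many values for \<open>g \<in> H\<close>. If \<open>k\<close> is infinite and \<open>a\<close> does not commute
  with \<open>x\<close>, the commutators \<open>g\<close> of \<open>x + t\<close> and \<open>a\<close> with \<open>t \<in> k\<close>, which lie in \<open>H\<close>, contradict this.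
  If \<open>k\<close> is finite, \<open>D\<close> is commutative by Wedderburn's theorem. In both cases \<open>a\<close> is
  central in \<open>D\<close>, hence lies in all conjugates of \<open>B\<close> and so in \<open>T\<close>, which forces \<open>a = 1\<close>.
  Thus \<open>U = 1\<close> and \<open>B = T\<close> is normalized by \<open>N\<close>, so by (BN2) there are no simple reflections.
\<close>

section \<open>Primitive roots of unity\<close>

text \<open>For \<open>n = 0\<close> the conditions are vacuous and the set is the whole complex
  plane, hence the hypotheses \<open>n \<ge> 1\<close> below.\<close>

definition primitive_roots :: "nat \<Rightarrow> complex set" where
  "primitive_roots n = {z. z ^ n = 1 \<and> (\<forall>j. 0 < j \<and> j < n \<longrightarrow> z ^ j \<noteq> 1)}"

lemma finite_primitive_roots: "n \<ge> 1 \<Longrightarrow> finite (primitive_roots n)"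
  by (rule finite_subset[OF _ finite_roots_unity[of n]]) (auto simp: primitive_roots_def)

text \<open>Each root of unity is primitive for its exact order, which divides \<open>n\<close>.
  This grouping allows induction over divisors.\<close>

lemma roots_unity_eq_Union_primitive_roots:
  assumes "n \<ge> 1"
  shows "{z::complex. z ^ n = 1} = (\<Union>d\<in>{d. d dvd n}. primitive_roots d)"
proof (intro equalityI subsetI)
  fix z :: complex assume "z \<in> {z. z ^ n = 1}"
  then have zn: "z ^ n = 1" by simp
  define d where "d = (LEAST d. 0 < d \<and> z ^ d = 1)"
  have d: "0 < d \<and> z ^ d = 1"
    unfolding d_def by (rule LeastI[of _ n]) (use assms zn in auto)
  have min: "z ^ j \<noteq> 1" if "0 < j" "j < d" for j
    using not_less_Least[of j "\<lambda>d. 0 < d \<and> z ^ d = 1"] that by (auto simp: d_def)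
  have "z ^ n = (z ^ d) ^ (n div d) * z ^ (n mod d)"
    by (simp flip: power_mult power_add)
  then have "z ^ (n mod d) = 1" using zn d by simp
  then have "n mod d = 0" using min[of "n mod d"] d by fastforce
  then have "d dvd n" by auto
  moreover have "z \<in> primitive_roots d" using d min by (auto simp: primitive_roots_def)
  ultimately show "z \<in> (\<Union>d\<in>{d. d dvd n}. primitive_roots d)" by blast
next
  fix z assume "z \<in> (\<Union>d\<in>{d. d dvd n}. primitive_roots d)"
  then show "z \<in> {z. z ^ n = 1}"
    by (auto simp: primitive_roots_def elim!: dvdE) (simp add: power_mult)
qed

lemma primitive_roots_disjoint:
  assumes "0 < m" "0 < n" "m \<noteq> n" shows "primitive_roots m \<inter> primitive_roots n = {}"
proof -
  have "m < n \<or> n < m" using assms by linarith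
  then show ?thesis using assms unfolding primitive_roots_def by blast
qed

text \<open>Either \<open>z ^ j\<close> is 1 at every root and the sum counts the roots, or some
  root \<open>w\<close> has \<open>w ^ j \<noteq> 1\<close>. In the second case multiplication by
  \<open>w\<close> permutes the roots and scales the sum by \<open>w ^ j\<close>, so the sum is
  0.\<close>

lemma sum_powers_roots_unity_in_Ints:
  assumes "n \<ge> 1"
  shows "(\<Sum>z | z ^ n = (1::complex). z ^ j) \<in> \<int>"
proof (cases "\<forall>z::complex. z ^ n = 1 \<longrightarrow> z ^ j = 1")
  case True
  then have "(\<Sum>z | z ^ n = (1::complex). z ^ j) = (\<Sum>z | z ^ n = (1::complex). 1)"
    by (intro sum.cong) auto
  then show ?thesis by simp
next
  case False
  then obtain w :: complex where w: "w ^ n = 1" "w ^ j \<noteq> 1" by blast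
  have "w \<noteq> 0" using w assms by (auto simp: power_0_left)
  have "bij_betw ((*) w) {z. z ^ n = 1} {z. z ^ n = 1}"
    by (rule bij_betw_byWitness[where f' = "\<lambda>z. z / w"])
       (use w \<open>w \<noteq> 0\<close> in \<open>auto simp: power_mult_distrib power_divide\<close>)
  then have "(\<Sum>z | z ^ n = 1. (w * z) ^ j) = (\<Sum>z | z ^ n = 1. z ^ j)"
    by (rule sum.reindex_bij_betw)
  then have "w ^ j * (\<Sum>z | z ^ n = 1. z ^ j) = (\<Sum>z | z ^ n = 1. z ^ j)"
    by (simp add: power_mult_distrib sum_distrib_left)
  then have "(\<Sum>z | z ^ n = (1::complex). z ^ j) = 0" using w by auto
  then show ?thesis by simp
qed

text \<open>These sums are the traces of the powers of a primitive root of unity. Strong induction: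
  subtract the sums belonging to proper divisors of \<open>n\<close> from the sum over all
  \<open>n\<close>-th roots of unity.\<close>

lemma sum_powers_primitive_roots_in_Ints:
  assumes "n \<ge> 1" shows "(\<Sum>z\<in>primitive_roots n. z ^ j) \<in> \<int>"
  using assms
proof (induction n rule: less_induct)
  case (less n)
  let ?D = "{d. d dvd n}"
  have fin: "finite ?D" using less.prems by simp
  have pos: "1 \<le> d" if "d \<in> ?D" for d using that less.prems by (auto intro: Nat.gr0I)
  have "(\<Sum>z | z ^ n = (1::complex). z ^ j) = (\<Sum>d\<in>?D. \<Sum>z\<in>primitive_roots d. z ^ j)"
    unfolding roots_unity_eq_Union_primitive_roots[OF less.prems]
  proof (rule sum.UNION_disjoint)
    show "\<forall>d\<in>?D. finite (primitive_roots d)" using pos finite_primitive_roots by blast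
    show "\<forall>d\<in>?D. \<forall>e\<in>?D. d \<noteq> e \<longrightarrow> primitive_roots d \<inter> primitive_roots e = {}"
      using pos by (intro ballI impI primitive_roots_disjoint) (auto simp: Suc_le_eq)
  qed (rule fin)
  also have "\<dots> = (\<Sum>z\<in>primitive_roots n. z ^ j) + (\<Sum>d\<in>?D - {n}. \<Sum>z\<in>primitive_roots d. z ^ j)"
    using fin by (intro sum.remove) auto
  finally have "(\<Sum>z\<in>primitive_roots n. z ^ j) =
      (\<Sum>z | z ^ n = (1::complex). z ^ j) - (\<Sum>d\<in>?D - {n}. \<Sum>z\<in>primitive_roots d. z ^ j)"
    by simp
  moreover have "(\<Sum>d\<in>?D - {n}. \<Sum>z\<in>primitive_roots d. z ^ j) \<in> \<int>"
  proof (rule Ints_sum)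
    fix d assume d: "d \<in> ?D - {n}"
    then have "d < n" using less.prems by (auto dest: dvd_imp_le)
    with d show "(\<Sum>z\<in>primitive_roots d. z ^ j) \<in> \<int>" using less.IH pos by auto
  qed
  ultimately show ?case using sum_powers_roots_unity_in_Ints[OF less.prems] by simp
qed

section \<open>Integer polynomials evaluated at primitive roots of unity\<close>

abbreviation cpoly :: "int poly \<Rightarrow> complex \<Rightarrow> complex" where
  "cpoly p z \<equiv> poly (map_poly of_int p) z"

lemma cpoly_simps:
  "cpoly (p + r) z = cpoly p z + cpoly r z" "cpoly (p - r) z = cpoly p z - cpoly r z"
  "cpoly (p * r) z = cpoly p z * cpoly r z" "cpoly (p ^ k) z = cpoly p z ^ k"
  "cpoly [:c:] z = of_int c" "cpoly (monom 1 k) z = z ^ k"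
  "cpoly (sum f A) z = (\<Sum>x\<in>A. cpoly (f x) z)"
  by (simp_all add: hom_distribs poly_monom poly_sum)

lemma sum_cpoly_primitive_roots_in_Ints:
  assumes "n \<ge> 1" shows "(\<Sum>z\<in>primitive_roots n. cpoly p z) \<in> \<int>"
proof -
  have "(\<Sum>z\<in>primitive_roots n. cpoly p z) =
      (\<Sum>i\<le>degree p. of_int (coeff p i) * (\<Sum>z\<in>primitive_roots n. z ^ i))"
    by (subst poly_altdef) (simp add: sum_distrib_left, subst sum.swap, simp)
  also have "\<dots> \<in> \<int>"
    by (intro Ints_sum[where f = "\<lambda>i. of_int (coeff p i) * (\<Sum>z\<in>primitive_roots n. z ^ i)"] Ints_mult
          Ints_of_int sum_powers_primitive_roots_in_Ints assms)
  finally show ?thesis .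
qed

text \<open>
  Divisibility of \<open>k\<close> by \<open>q - z\<close> in the ring generated by a primitive root \<open>z\<close>, where one and the
  same integer polynomial gives the cofactor for all \<open>z\<close>.
\<close>
definition primroot_dvd :: "nat \<Rightarrow> int \<Rightarrow> int \<Rightarrow> bool" where
  "primroot_dvd n q k \<longleftrightarrow>
     (\<exists>p. \<forall>z\<in>primitive_roots n. of_int k = (of_int q - z) * cpoly p z)"

lemma primroot_dvd_sum:
  assumes "\<And>x. x \<in> A \<Longrightarrow> primroot_dvd n q (f x)" shows "primroot_dvd n q (sum f A)"
proof -
  obtain p where "\<And>x z. x \<in> A \<Longrightarrow> z \<in> primitive_roots n \<Longrightarrow>
      of_int (f x) = (of_int q - z) * cpoly (p x) z"
    using assms unfolding primroot_dvd_def by metis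
  then show ?thesis
    unfolding primroot_dvd_def
    by (intro exI[of _ "sum p A"]) (simp add: cpoly_simps sum_distrib_left)
qed

lemma primroot_dvd_diff:
  assumes "primroot_dvd n q k" "primroot_dvd n q l" shows "primroot_dvd n q (k - l)"
proof -
  obtain p r where "\<forall>z\<in>primitive_roots n. of_int k = (of_int q - z) * cpoly p z"
    "\<forall>z\<in>primitive_roots n. of_int l = (of_int q - z) * cpoly r z"
    using assms unfolding primroot_dvd_def by blast
  then show ?thesis
    unfolding primroot_dvd_def
    by (intro exI[of _ "p - r"]) (simp add: cpoly_simps right_diff_distrib)
qed

text \<open>Division of \<open>p\<close> by \<open>X - q\<close> leaves the remainder
  \<open>poly p q\<close> and a quotient with integer coefficients. Where \<open>p\<close> vanishes,
  that quotient is the required cofactor.\<close>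

lemma primroot_dvd_poly:
  assumes "\<And>z. z \<in> primitive_roots n \<Longrightarrow> cpoly p z = 0" shows "primroot_dvd n q (poly p q)"
  unfolding primroot_dvd_def
proof (intro exI[of _ "synthetic_div p q"] ballI)
  fix z assume "z \<in> primitive_roots n"
  then have "cpoly p z = 0" by (rule assms)
  also have "p = monom 1 1 * synthetic_div p q - [:q:] * synthetic_div p q + [:poly p q:]"
    using synthetic_div_correct'[of q p] by (simp add: monom_altdef algebra_simps)
  finally show "of_int (poly p q) = (of_int q - z) * cpoly (synthetic_div p q) z"
    unfolding cpoly_simps by (simp add: algebra_simps)
qed

text \<open>
  All conjugates \<open>p(z)\<close> of a cofactor of \<open>q - 1\<close> have absolute value below 1. The sums of the powers
  \<open>\<bar>p(z)\<bar>\<^bsup>2k\<^esup>\<close> over all \<open>z\<close> are then positive integers tending to 0.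
\<close>
lemma not_primroot_dvd:
  assumes "n \<ge> 2" "q \<ge> 2" shows "\<not> primroot_dvd n q (q - 1)"
proof
  assume "primroot_dvd n q (q - 1)"
  then obtain p where p: "\<And>z. z \<in> primitive_roots n \<Longrightarrow>
      of_int (q - 1) = (of_int q - z) * cpoly p z"
    unfolding primroot_dvd_def by blast
  let ?P = "primitive_roots n"
  have norm1: "norm z = 1" if "z \<in> ?P" for z
    using that assms power_eq_1_iff[of z n] by (simp add: primitive_roots_def)
  have ne1: "z \<noteq> 1" if "z \<in> ?P" for z
    using that assms unfolding primitive_roots_def by auto
  have nz: "cpoly p z \<noteq> 0" if "z \<in> ?P" for z
  proof
    assume "cpoly p z = 0"
    then have "of_int (q - 1) = (0::complex)" using p[OF that] by simp
    then show False using assms by (simp del: of_int_diff)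
  qed
  have less1: "norm (cpoly p z) < 1" if z: "z \<in> ?P" for z
  proof -
    \<comment> \<open>A point of the unit circle other than 1 has real part below 1, so
      \<open>q - z\<close> is strictly longer than \<open>q - 1\<close>.\<close>
    have "Re z < 1"
    proof (rule ccontr)
      assume "\<not> Re z < 1"
      moreover have "Re z \<le> 1" using complex_Re_le_cmod[of z] norm1[OF z] by simp
      ultimately have "Re z = 1" by simp
      moreover from this have "Im z = 0" using norm1[OF z] by (simp add: cmod_def)
      ultimately show False using ne1[OF z] by (simp add: complex_eq_iff)
    qed
    then have "of_int q - 1 < Re (of_int q - z)" by simp
    also have "\<dots> \<le> norm (of_int q - z)" by (rule complex_Re_le_cmod)
    finally have 1: "of_int q - 1 < norm (of_int q - z)" .
    have "norm (of_int q - z) * norm (cpoly p z) = of_int q - 1"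
      using arg_cong[OF p[OF z], of norm] assms by (simp add: norm_mult flip: of_int_diff)
    then show ?thesis
      using 1 assms by (smt (verit) mult_le_cancel_left1 of_int_le_1_iff)
  qed
  have fin: "finite ?P" using assms by (intro finite_primitive_roots) simp
  \<comment> \<open>A primitive root exists, so the sums \<open>S k\<close> below are nonempty and
    therefore positive.\<close>
  have cis: "cis (2 * pi / n) \<in> ?P"
    unfolding primitive_roots_def
  proof (intro CollectI conjI allI impI notI)
    show "cis (2 * pi / n) ^ n = 1" using assms by (simp add: Complex.DeMoivre)
    fix j :: nat assume j: "0 < j \<and> j < n" "cis (2 * pi / n) ^ j = 1"
    then have "cos (real j * (2 * pi / n)) = 1"
      by (simp add: Complex.DeMoivre complex_eq_iff)
    then obtain k :: int where "real j * (2 * pi / n) = of_int k * 2 * pi"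
      by (auto simp: cos_one_2pi_int)
    then have "real j = of_int k * n" using assms by (simp add: field_simps)
    then have "int j = k * int n" by (metis of_int_eq_iff of_int_mult of_int_of_nat_eq)
    then have "int n dvd int j" by simp
    then show False using j by (simp add: nat_dvd_not_less)
  qed
  define S where "S k = (\<Sum>z\<in>?P. norm (cpoly p z) ^ (2 * k))" for k
  have pos: "S k > 0" for k
    unfolding S_def by (rule sum_pos) (use fin cis nz in auto)
  have int: "S k \<in> \<int>" for k
  proof -
    \<comment> \<open>On the roots, complex conjugation is \<open>z \<mapsto> z ^ (n - 1)\<close>,
      so the squared absolute value of \<open>p(z)\<close> is again an integer polynomial in
      \<open>z\<close>.\<close>
    have "complex_of_real (S k) = (\<Sum>z\<in>?P. cpoly (p ^ k * (p \<circ>\<^sub>p monom 1 (n - 1)) ^ k) z)"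
      unfolding S_def of_real_sum
    proof (rule sum.cong)
      fix z assume z: "z \<in> ?P"
      have "cnj z * z = 1" using norm1[OF z] by (simp add: complex_norm_square[symmetric] mult.commute)
      moreover have "z ^ (n - 1) * z = 1" using z assms
        by (simp add: primitive_roots_def flip: power_Suc2)
      ultimately have cnj: "cnj z = z ^ (n - 1)" by (metis mult_cancel_right mult_zero_right zero_neq_one)
      have "complex_of_real (norm (cpoly p z) ^ 2) = cpoly p z * cnj (cpoly p z)"
        by (rule complex_norm_square)
      also have "cnj (cpoly p z) = cpoly p (cnj z)"
        by (simp add: poly_altdef)
      also have "\<dots> = cpoly (p \<circ>\<^sub>p monom 1 (n - 1)) z"
        by (simp add: cnj of_int_hom.map_poly_pcompose poly_pcompose poly_monom)
      finally show "complex_of_real (norm (cpoly p z) ^ (2 * k)) =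
          cpoly (p ^ k * (p \<circ>\<^sub>p monom 1 (n - 1)) ^ k) z"
        unfolding cpoly_simps by (simp add: power_mult power_mult_distrib)
    qed simp
    then have "complex_of_real (S k) \<in> \<int>"
      using sum_cpoly_primitive_roots_in_Ints[of n] assms by simp
    then show ?thesis by (metis Ints_cases Ints_of_int of_real_eq_iff of_real_of_int_eq)
  qed
  have "S \<longlonglongrightarrow> (\<Sum>z\<in>?P. 0)"
    unfolding S_def
  proof (rule tendsto_sum)
    fix z assume z: "z \<in> ?P"
    have "(\<lambda>k. (norm (cpoly p z) ^ 2) ^ k) \<longlonglongrightarrow> 0"
      by (rule LIMSEQ_power_zero) (use less1[OF z] in \<open>simp add: power_less_one_iff\<close>)
    then show "(\<lambda>k. norm (cpoly p z) ^ (2 * k)) \<longlonglongrightarrow> 0" by (simp add: power_mult)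
  qed
  then have "eventually (\<lambda>k. S k < 1) sequentially"
    by (intro order_tendstoD(2)) auto
  then obtain k where "S k < 1" by (auto simp: eventually_sequentially)
  with pos[of k] int[of k] show False by (metis Ints_cases of_int_0_less_iff of_int_less_1_iff int_one_le_iff_zero_less not_less)
qed

section \<open>Wedderburn's little theorem\<close>

text \<open>Among the left \<open>S\<close>-submodules of \<open>R\<close> whose size is a power of
  \<open>card S\<close>, one of maximal size is all of \<open>R\<close>: an element \<open>x\<close>
  outside \<open>V\<close> would give the larger \<open>V + S x\<close> with
  \<open>card V * card S\<close> elements.\<close>

lemma card_module_over_subdivision_ring:
  fixes S R :: "'d::division_ring set"
  assumes fin: "finite R"
    and S: "0 \<in> S" "1 \<in> S" "\<And>x y. x \<in> S \<Longrightarrow> y \<in> S \<Longrightarrow> x - y \<in> S"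
      "\<And>x y. x \<in> S \<Longrightarrow> y \<in> S \<Longrightarrow> x * y \<in> S" "\<And>x. x \<in> S \<Longrightarrow> inverse x \<in> S"
    and R: "0 \<in> R" "\<And>x y. x \<in> R \<Longrightarrow> y \<in> R \<Longrightarrow> x - y \<in> R"
      "\<And>s x. s \<in> S \<Longrightarrow> x \<in> R \<Longrightarrow> s * x \<in> R"
    and fS: "finite S"
  shows "\<exists>m. card R = card S ^ m"
proof -
  define sub where "sub V \<longleftrightarrow> V \<subseteq> R \<and> 0 \<in> V \<and> (\<forall>x\<in>V. \<forall>y\<in>V. x - y \<in> V) \<and>
    (\<forall>s\<in>S. \<forall>x\<in>V. s * x \<in> V) \<and> (\<exists>i. card V = card S ^ i)" for V
  have "sub {0}" unfolding sub_def using R by (auto intro: exI[of _ 0])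
  have "finite {V. sub V}" by (rule finite_subset[of _ "Pow R"]) (auto simp: sub_def fin)
  then obtain V where V: "sub V" and max: "\<And>W. sub W \<Longrightarrow> card W \<le> card V"
    using Max_in[of "card ` {V. sub V}"] Max_ge[of "card ` {V. sub V}"] \<open>sub {0}\<close>
    by (smt (verit) empty_iff finite_imageI image_iff mem_Collect_eq)
  have finV: "finite V" using V fin by (auto simp: sub_def intro: finite_subset)
  have addR: "x + y \<in> R" if "x \<in> R" "y \<in> R" for x y
    using R(2)[OF that(1) R(2)[OF R(1) that(2)]] by simp
  have addV: "x + y \<in> V" if "x \<in> V" "y \<in> V" for x y
  proof -
    have "x - (0 - y) \<in> V" using that V unfolding sub_def by blast
    then show ?thesis by simp
  qed
  have "R \<subseteq> V"
  proof
    fix x assume x: "x \<in> R"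
    show "x \<in> V"
    proof (rule ccontr)
      assume xV: "x \<notin> V"
      define W where "W = (\<lambda>(v, s). v + s * x) ` (V \<times> S)"
      have inj: "inj_on (\<lambda>(v, s). v + s * x) (V \<times> S)"
      proof (rule inj_onI, clarify)
        fix v s v' s' assume *: "v \<in> V" "s \<in> S" "v' \<in> V" "s' \<in> S" "v + s * x = v' + s' * x"
        then have **: "(s - s') * x = v' - v" by (simp add: algebra_simps)
        \<comment> \<open>Otherwise \<open>x\<close> would be an \<open>S\<close>-multiple of
          \<open>v' - v\<close> and hence lie in \<open>V\<close>; inverses in \<open>S\<close>
          enter here.\<close>
        have "s = s'"
        proof (rule ccontr)
          assume "s \<noteq> s'"
          then have "inverse (s - s') * ((s - s') * x) = x"
            by (simp add: mult.assoc[symmetric])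
          moreover have "inverse (s - s') * (v' - v) \<in> V"
            using V S * by (simp add: sub_def)
          ultimately show False using ** xV by simp
        qed
        with * show "v = v' \<and> s = s'" by simp
      qed
      have "card W = card V * card S"
        unfolding W_def using card_image[OF inj] by (simp add: card_cartesian_product)
      moreover obtain i where "card V = card S ^ i" using V by (auto simp: sub_def)
      ultimately have cardW: "card W = card S ^ Suc i" "card W = card V * card S" by simp_all
      have "sub W"
        unfolding sub_def
      proof (intro conjI ballI)
        show "W \<subseteq> R" using V x R(3) addR by (auto simp: W_def sub_def subset_iff)
        show "0 \<in> W" unfolding W_def using V S by (intro image_eqI[of _ _ "(0, 0)"]) (auto simp: sub_def)
        show "\<exists>i. card W = card S ^ i" using cardW by blast
      next
        fix w w' assume "w \<in> W" "w' \<in> W"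
        then obtain v s v' s' where "v \<in> V" "s \<in> S" "v' \<in> V" "s' \<in> S" "w = v + s * x" "w' = v' + s' * x"
          unfolding W_def by auto
        then have "w - w' = (\<lambda>(v, s). v + s * x) (v - v', s - s')" "(v - v', s - s') \<in> V \<times> S"
          using V S by (auto simp: algebra_simps sub_def)
        then show "w - w' \<in> W" unfolding W_def by (rule image_eqI)
      next
        fix t w assume "t \<in> S" "w \<in> W"
        then obtain v s where "v \<in> V" "s \<in> S" "w = v + s * x" unfolding W_def by auto
        then have "t * w = (\<lambda>(v, s). v + s * x) (t * v, t * s)" "(t * v, t * s) \<in> V \<times> S"
          using V S \<open>t \<in> S\<close> by (auto simp: algebra_simps sub_def)
        then show "t * w \<in> W" unfolding W_def by (rule image_eqI)
      qed
      have "card {0, 1::'d} \<le> card S" by (rule card_mono) (use fS S in auto)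
      then have "card S \<ge> 2" by simp
      moreover have "card V > 0" using V finV by (auto simp: sub_def card_gt_0_iff)
      ultimately have "card V < card W" using cardW(2) by simp
      with max[OF \<open>sub W\<close>] show False by simp
    qed
  qed
  then have "R = V" using V by (auto simp: sub_def)
  then show ?thesis using V by (auto simp: sub_def)
qed

section \<open>Conjugacy classes and centralizers\<close>

definition conj_class :: "'d::division_ring \<Rightarrow> 'd set" where
  "conj_class x = {g * x * inverse g | g. g \<noteq> 0}"

definition centralizer :: "'d::division_ring \<Rightarrow> 'd set" where
  "centralizer x = {g. g * x = x * g}"

lemma self_in_conj_class: "x \<in> conj_class x"
  unfolding conj_class_def by (rule CollectI, rule exI[of _ 1]) simp

lemma conj_class_subset:
  assumes "y \<in> conj_class x" shows "conj_class y \<subseteq> conj_class x"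
proof
  obtain g where g: "g \<noteq> 0" "y = g * x * inverse g" using assms by (auto simp: conj_class_def)
  fix z assume "z \<in> conj_class y"
  then obtain h where h: "h \<noteq> 0" "z = h * y * inverse h" by (auto simp: conj_class_def)
  have "z = (h * g) * x * inverse (h * g)"
    using g h by (simp add: nonzero_inverse_mult_distrib mult.assoc)
  then show "z \<in> conj_class x" using g h unfolding conj_class_def by fastforce
qed

lemma conj_class_sym:
  assumes "y \<in> conj_class x" shows "x \<in> conj_class y"
proof -
  obtain g where g: "g \<noteq> 0" "y = g * x * inverse g" using assms by (auto simp: conj_class_def)
  have "inverse g * y * inverse (inverse g) = (inverse g * g) * x * (inverse g * g)"
    using g(2) nonzero_inverse_inverse_eq[OF g(1)] by (simp add: mult.assoc)
  then have "x = inverse g * y * inverse (inverse g)" using g by simp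
  then show ?thesis using g unfolding conj_class_def by fastforce
qed

lemma conj_class_eq: "y \<in> conj_class x \<Longrightarrow> conj_class y = conj_class x"
  by (simp add: conj_class_subset conj_class_sym subset_antisym)

text \<open>Orbit counting for conjugation by nonzero elements: the fibre of
  \<open>g \<mapsto> g * x * inverse g\<close> over \<open>h * x * inverse h\<close> is
  \<open>h\<close> times the nonzero part of the centralizer. Both subtractions of 1 remove the
  element 0.\<close>

lemma card_conj_class:
  fixes x :: "'d::division_ring"
  assumes "finite (UNIV :: 'd set)"
  shows "card (conj_class x) * (card (centralizer x) - 1) = card (UNIV :: 'd set) - 1"
proof -
  let ?X = "UNIV - {0::'d}"
  have fin: "finite A" for A :: "'d set" using assms by (rule finite_subset[rotated]) simp
  have fib: "card {g \<in> ?X. g * x * inverse g = y} = card (centralizer x) - 1" if y: "y \<in> conj_class x" for y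
  proof -
    obtain h where h: "h \<noteq> 0" "y = h * x * inverse h" using y by (auto simp: conj_class_def)
    have "bij_betw ((*) h) (centralizer x - {0}) {g \<in> ?X. g * x * inverse g = y}"
    proof (rule bij_betw_byWitness[where f' = "(*) (inverse h)"])
      show "\<forall>a\<in>centralizer x - {0}. inverse h * (h * a) = a"
        using h by (simp add: mult.assoc[symmetric])
      show "\<forall>g\<in>{g \<in> ?X. g * x * inverse g = y}. h * (inverse h * g) = g"
        using h by (simp add: mult.assoc[symmetric])
      show "(*) h ` (centralizer x - {0}) \<subseteq> {g \<in> ?X. g * x * inverse g = y}"
      proof
        fix b assume "b \<in> (*) h ` (centralizer x - {0})"
        then obtain a where a: "a \<in> centralizer x" "a \<noteq> 0" and b: "b = h * a" by auto
        have "h * a * x * inverse (h * a) = h * (a * x) * inverse a * inverse h"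
          using a h by (simp add: nonzero_inverse_mult_distrib mult.assoc)
        also have "\<dots> = h * x * (a * inverse a) * inverse h"
          using a by (simp add: centralizer_def mult.assoc)
        finally show "b \<in> {g \<in> ?X. g * x * inverse g = y}" using a h b by simp
      qed
      show "(*) (inverse h) ` {g \<in> ?X. g * x * inverse g = y} \<subseteq> centralizer x - {0}"
      proof
        fix b assume "b \<in> (*) (inverse h) ` {g \<in> ?X. g * x * inverse g = y}"
        then obtain g where g: "g \<noteq> 0" "y = g * x * inverse g" and b: "b = inverse h * g" by auto
        have "inverse h * g * x = inverse h * (g * x * inverse g) * g"
          using g by (simp add: mult.assoc)
        also have "\<dots> = inverse h * (h * x * inverse h) * g" using g h by simp
        also have "\<dots> = x * (inverse h * g)" using h by (simp add: mult.assoc[symmetric])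
        finally show "b \<in> centralizer x - {0}"
          using g h b by (simp add: centralizer_def)
      qed
    qed
    then have "card {g \<in> ?X. g * x * inverse g = y} = card (centralizer x - {0})"
      by (simp add: bij_betw_same_card)
    then show ?thesis using fin by (simp add: centralizer_def)
  qed
  have "card ?X = (\<Sum>y\<in>conj_class x. \<Sum>g | g \<in> ?X \<and> g * x * inverse g = y. 1)"
    by (subst sum.group) (auto simp: fin conj_class_def)
  also have "\<dots> = card (conj_class x) * (card (centralizer x) - 1)"
    using fib by simp
  finally show ?thesis using fin by simp
qed

text \<open>Witt's argument by the class equation. With \<open>q\<close> elements in the center and
  \<open>q ^ n\<close> in the ring, noncentral classes have \<open>(q ^ n - 1) / (q ^ d - 1)\<close>
  elements for proper divisors \<open>d\<close> of \<open>n\<close>. If \<open>n \<ge> 2\<close>,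
  these sizes and \<open>q ^ n - 1\<close> are divisible by \<open>q - z\<close> in the sense of
  \<open>primroot_dvd\<close>; then so is \<open>q - 1\<close>, which
  \<open>not_primroot_dvd\<close> excludes.\<close>

theorem wedderburn_little:
  fixes x y :: "'d::division_ring"
  assumes fin: "finite (UNIV :: 'd set)"
  shows "x * y = y * x"
proof -
  have fin': "finite A" for A :: "'d set" using assms by (rule finite_subset[rotated]) simp
  let ?Q = "card (UNIV :: 'd set)"
  define F where "F = {z::'d. \<forall>x. z * x = x * z}"
  define q where "q = card F"
  have inv: "inverse z * x = x * inverse z" if "z * x = x * z" for z x :: 'd
  proof (cases "z = 0")
    case False
    have "inverse z * x = inverse z * (x * z) * inverse z" using False by (simp add: mult.assoc)
    also have "\<dots> = inverse z * (z * x) * inverse z" using that by simp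
    also have "\<dots> = x * inverse z" using False by (simp flip: mult.assoc)
    finally show ?thesis .
  qed simp
  have mul: "z * w * x = x * (z * w)" if "z * x = x * z" "w * x = x * w" for z w x :: 'd
    using that by (metis mult.assoc)
  have F_mult: "x * y \<in> F" if "x \<in> F" "y \<in> F" for x y
    using that mul unfolding F_def by blast
  have F_inverse: "inverse x \<in> F" if "x \<in> F" for x
    using that inv unfolding F_def by blast
  have F: "0 \<in> F" "1 \<in> F" "\<And>x y. x \<in> F \<Longrightarrow> y \<in> F \<Longrightarrow> x - y \<in> F"
    by (simp_all add: F_def left_diff_distrib right_diff_distrib)
  note F = F F_mult F_inverse
  have C_mult: "x * y \<in> centralizer a" if "x \<in> centralizer a" "y \<in> centralizer a" for x y a :: 'd
    using that mul unfolding centralizer_def by blast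
  have C_inverse: "inverse x \<in> centralizer a" if "x \<in> centralizer a" for x a :: 'd
    using that inv unfolding centralizer_def by blast
  have C: "0 \<in> centralizer a" "1 \<in> centralizer a"
    "\<And>x y. x \<in> centralizer a \<Longrightarrow> y \<in> centralizer a \<Longrightarrow> x - y \<in> centralizer a" for a :: 'd
    by (simp_all add: centralizer_def left_diff_distrib right_diff_distrib)
  note C = C C_mult C_inverse
  have "card {0, 1::'d} \<le> q" unfolding q_def by (rule card_mono) (use fin' F in auto)
  then have q2: "q \<ge> 2" by simp
  have "\<exists>m. ?Q = card F ^ m"
    by (rule card_module_over_subdivision_ring) (simp_all add: F fin')
  then obtain n where n: "?Q = q ^ n" unfolding q_def ..
  have cent: "\<exists>d. d dvd n \<and> card (centralizer a) = q ^ d" for a :: 'd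
  proof -
    have "s \<in> centralizer a" if "s \<in> F" for s
      using that by (simp add: F_def centralizer_def)
    then have "\<exists>m. card (centralizer a) = card F ^ m"
      by (intro card_module_over_subdivision_ring) (simp_all add: F C fin')
    then obtain d where d: "card (centralizer a) = q ^ d" unfolding q_def ..
    \<comment> \<open>The whole ring is also a module over the division ring
      \<open>centralizer a\<close>, which makes \<open>d\<close> a divisor of
      \<open>n\<close>.\<close>
    have "\<exists>m. ?Q = card (centralizer a) ^ m"
      by (rule card_module_over_subdivision_ring) (simp_all add: C fin')
    then obtain m where "?Q = card (centralizer a) ^ m" ..
    then have "q ^ n = q ^ (d * m)" using n d by (simp add: power_mult)
    then have "n = d * m" using q2 by simp
    with d show ?thesis by (metis dvd_triv_left)
  qed
  have "n \<noteq> 0"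
  proof
    assume "n = 0"
    then have "?Q = 1" using n by simp
    moreover have "card {0, 1::'d} \<le> ?Q" by (rule card_mono) (use fin' in auto)
    ultimately show False by simp
  qed
  have "n < 2"
  proof (rule ccontr)
    assume "\<not> n < 2"
    then have n2: "n \<ge> 2" by simp
    let ?X = "UNIV - {0::'d}"
    have dvd_n: "primroot_dvd n (int q) (int q ^ n - 1)"
      using primroot_dvd_poly[of n "monom 1 n - [:1:]" "int q"] unfolding cpoly_simps
      by (simp add: primitive_roots_def poly_monom)
    have dvd_class: "primroot_dvd n (int q) (int (card (conj_class x)))" if x: "x \<notin> F" for x
    proof -
      obtain d where d: "d dvd n" "card (centralizer x) = q ^ d" using cent by blast
      then obtain m where m: "n = d * m" by auto
      have d0: "d > 0" using m n2 by (auto intro: Nat.gr0I)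
      have "d \<noteq> n"
      proof
        assume "d = n"
        then have "centralizer x = UNIV" using d n fin' by (metis card_subset_eq subset_UNIV)
        then show False using x by (auto simp: F_def centralizer_def set_eq_iff)
      qed
      then have dn: "d < n" using d n2 by (metis dvd_imp_le le_neq_implies_less not_numeral_le_zero zero_less_iff_neq_zero)
      \<comment> \<open>\<open>G\<close> is the polynomial \<open>(X ^ n - 1) / (X ^ d - 1)\<close>.
        It vanishes at the primitive \<open>n\<close>-th roots because \<open>0 < d < n\<close>, and
        its value at \<open>q\<close> is the class size.\<close>
      define G where "G = (\<Sum>i<m. monom (1::int) (d * i))"
      have "primroot_dvd n (int q) (poly G (int q))"
      proof (rule primroot_dvd_poly)
        fix z assume z: "z \<in> primitive_roots n"
        have "cpoly G z = (\<Sum>i<m. (z ^ d) ^ i)" unfolding G_def cpoly_simps by (simp add: power_mult)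
        moreover have "(1 - z ^ d) * (\<Sum>i<m. (z ^ d) ^ i) = 1 - z ^ n"
          by (simp add: one_diff_power_eq m power_mult)
        moreover have "z ^ n = 1" "z ^ d \<noteq> 1" using z d0 dn by (auto simp: primitive_roots_def)
        ultimately show "cpoly G z = 0" by auto
      qed
      moreover have "poly G (int q) = int (card (conj_class x))"
      proof -
        have "poly G (int q) = (\<Sum>i<m. (int q ^ d) ^ i)"
          unfolding G_def by (simp add: poly_sum poly_monom power_mult)
        then have "(int q ^ d - 1) * poly G (int q) = int q ^ n - 1"
          by (simp add: power_diff_1_eq m power_mult)
        moreover have "int (card (conj_class x)) * (int q ^ d - 1) = int q ^ n - 1"
        proof -
          have "int (card (conj_class x) * (q ^ d - 1)) = int (q ^ n - 1)"
            using card_conj_class[OF fin, of x] d n by simp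
          then show ?thesis using q2 by (simp add: of_nat_diff)
        qed
        moreover have "int q ^ d - 1 > 0" using q2 d0 by (simp add: one_less_power)
        ultimately show ?thesis by (metis mult.commute mult_left_cancel less_numeral_extra(3))
      qed
      ultimately show ?thesis by simp
    qed
    \<comment> \<open>The class equation, restricted to noncentral elements.\<close>
    have "card (?X - F) = (\<Sum>c\<in>conj_class ` (?X - F). \<Sum>x | x \<in> ?X - F \<and> conj_class x = c. 1)"
      by (subst sum.group) (auto simp: fin')
    also have "\<dots> = (\<Sum>c\<in>conj_class ` (?X - F). card c)"
    proof (rule sum.cong[OF refl])
      fix c assume "c \<in> conj_class ` (?X - F)"
      then obtain x where x: "x \<notin> F" "x \<noteq> 0" "c = conj_class x" by auto
      have "y \<noteq> 0 \<and> y \<notin> F" if "y \<in> c" for y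
      proof -
        have "x \<in> conj_class y" using conj_class_eq that self_in_conj_class x by blast
        then obtain g where g: "x = g * y * inverse g" "g \<noteq> 0" by (auto simp: conj_class_def)
        then have "x = y" if "y \<in> F"
          using that by (simp add: F_def mult.assoc) (simp flip: mult.assoc)
        then show ?thesis using x g by auto
      qed
      then have "{y. y \<in> ?X - F \<and> conj_class y = c} = c"
        using x conj_class_eq self_in_conj_class by blast
      then show "(\<Sum>x | x \<in> ?X - F \<and> conj_class x = c. 1) = card c" by simp
    qed
    finally have "int (card (?X - F)) = (\<Sum>c\<in>conj_class ` (?X - F). int (card c))" by simp
    moreover have "primroot_dvd n (int q) \<dots>"
      by (rule primroot_dvd_sum) (auto intro: dvd_class)
    moreover have "int (card (?X - F)) = (int q ^ n - 1) - (int q - 1)"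
    proof -
      have "?X - F = UNIV - F" using F by auto
      then have "card (?X - F) = q ^ n - q" using fin' n by (simp add: card_Diff_subset q_def)
      moreover have "q \<le> q ^ n" using q2 n2 by (metis le_trans self_le_power one_le_numeral not_gr0 not_numeral_le_zero)
      ultimately show ?thesis by (simp add: of_nat_diff)
    qed
    ultimately have "primroot_dvd n (int q) ((int q ^ n - 1) - (int q - 1))" by simp
    then have "primroot_dvd n (int q) (int q - 1)"
      using primroot_dvd_diff[OF dvd_n] by fastforce
    then show False using not_primroot_dvd[of n "int q"] n2 q2 by simp
  qed
  with \<open>n \<noteq> 0\<close> have "card F = ?Q" using n by (simp add: q_def less_2_cases_iff)
  then have "F = UNIV" using fin by (metis card_subset_eq subset_UNIV)
  then show ?thesis by (auto simp: F_def)
qed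

section \<open>The Bruhat decomposition\<close>

text \<open>The last nontrivial term of the lower central series is central, since commutators with
  its elements lie in the next term.\<close>

lemma nilpotent_group_nontrivial_center:
  fixes G (structure)
  assumes "nilpotent_group G" "carrier G \<noteq> {\<one>}"
  shows "\<exists>a\<in>carrier G. a \<noteq> \<one> \<and> (\<forall>x\<in>carrier G. x \<otimes> a = a \<otimes> x)"
proof -
  interpret group G using assms by (simp add: nilpotent_group_def)
  define n where "n = (LEAST i. lower_central G i = {\<one>})"
  have ex: "\<exists>i. lower_central G i = {\<one>}" using assms by (simp add: nilpotent_group_def)
  have n: "lower_central G n = {\<one>}" unfolding n_def using ex by (rule LeastI_ex)
  then have "n \<noteq> 0" using assms(2) by (cases n) auto
  then obtain m where m: "n = Suc m" by (cases n) auto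
  have ne: "lower_central G m \<noteq> {\<one>}"
    using not_less_Least[of m "\<lambda>i. lower_central G i = {\<one>}"] m unfolding n_def by auto
  have sub: "subgroup (lower_central G i) G" for i
  proof (induction i)
    case (Suc i)
    show ?case unfolding lower_central.simps
      by (rule generate_is_subgroup) (use subgroup.subset[OF Suc] in auto)
  qed (simp add: subgroup_self)
  obtain a where a: "a \<in> lower_central G m" "a \<noteq> \<one>"
    using ne subgroup.one_closed[OF sub[of m]] by blast
  have aG: "a \<in> carrier G" using a subgroup.subset[OF sub] by blast
  have "x \<otimes> a = a \<otimes> x" if x: "x \<in> carrier G" for x
  proof -
    have "x \<otimes> a \<otimes> inv x \<otimes> inv a \<in> lower_central G n"
      unfolding m lower_central.simps by (rule generate.incl) (use x a in blast)
    then have "x \<otimes> a \<otimes> inv x \<otimes> inv a = \<one>" using n by simp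
    from inv_equality[OF this] have xa: "x \<otimes> a \<otimes> inv x = a" using x aG by simp
    have "x \<otimes> a = x \<otimes> a \<otimes> inv x \<otimes> x" using x aG by (simp add: m_assoc)
    then show ?thesis unfolding xa .
  qed
  with a aG show ?thesis by blast
qed

text \<open>In a finite group inverses are powers, so closure under products is enough. This is
  applied to the Weyl group and its generating set of simple reflections.\<close>

lemma (in group) generate_closed_if_finite:
  assumes fin: "finite (carrier G)" and S: "S \<subseteq> carrier G" and one: "P \<one>"
    and mult: "\<And>x y. x \<in> carrier G \<Longrightarrow> y \<in> carrier G \<Longrightarrow> P x \<Longrightarrow> P y \<Longrightarrow> P (x \<otimes> y)"
    and base: "\<And>s. s \<in> S \<Longrightarrow> P s" and g: "g \<in> generate G S"
  shows "P g"
proof -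
  have pow: "P (x [^] (n::nat))" if "x \<in> carrier G" "P x" for x n
    by (induction n) (use that one mult in auto)
  show ?thesis
    using g
  proof (induction rule: generate.induct)
    case (inv s)
    then have s: "s \<in> carrier G" using S by blast
    have "s [^] (Coset.order G - 1) \<otimes> s = s [^] Suc (Coset.order G - 1)" by simp
    also have "Suc (Coset.order G - 1) = Coset.order G" using fin order_gt_0_iff_finite by simp
    also have "s [^] Coset.order G = \<one>" using s by (rule pow_order_eq_1)
    finally have "inv s = s [^] (Coset.order G - 1)" using s by (simp add: inv_equality)
    then show ?case using pow[OF s base[OF inv]] by simp
  next
    case (eng x y)
    then show ?case using mult generate_in_carrier[OF S] by blast
  qed (use one base in auto)
qed

section \<open>BN-pairs and their double cosets\<close>

locale bn_pair = group G for G :: "('a, 'b) monoid_scheme" (structure) +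
  fixes B N :: "'a set"
  assumes BN: "BN_pair G B N"
begin

abbreviation T where "T \<equiv> B \<inter> N"
abbreviation W where "W \<equiv> weyl_group G B N"

lemma subgroup_B: "subgroup B G"
  using BN by (simp add: BN_pair_def)

lemma subgroup_N: "subgroup N G"
  using BN by (simp add: BN_pair_def)

lemma generate_BN: "generate G (B \<union> N) = carrier G"
  using BN by (simp add: BN_pair_def)

lemma T_normal: "T \<lhd> G\<lparr>carrier := N\<rparr>"
  using BN by (simp add: BN_pair_def)

lemma B_carrier: "x \<in> B \<Longrightarrow> x \<in> carrier G"
  by (rule subgroup.mem_carrier[OF subgroup_B])

lemma N_carrier: "x \<in> N \<Longrightarrow> x \<in> carrier G"
  by (rule subgroup.mem_carrier[OF subgroup_N])

lemma group_W: "group W"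
  unfolding weyl_group_def using T_normal by (rule normal.factorgroup_is_group)

lemma carrier_W: "carrier W = (\<lambda>n. T #> n) ` N"
  by (auto simp: weyl_group_def FactGroup_def RCOSETS_def r_coset_def)

lemma one_W: "\<one>\<^bsub>W\<^esub> = T"
  by (simp add: weyl_group_def FactGroup_def)

lemma mult_W: "x \<otimes>\<^bsub>W\<^esub> y = x <#> y"
  by (simp add: weyl_group_def FactGroup_def set_mult_def)

lemma mem_coset: "n \<in> N \<Longrightarrow> n \<in> T #> n"
  using subgroup.one_closed[OF subgroup_B] subgroup.one_closed[OF subgroup_N] N_carrier
  unfolding r_coset_def by (intro UN_I[of \<one>]) simp_all

lemma coset_subset_N: "w \<in> carrier W \<Longrightarrow> w \<subseteq> N"
  unfolding carrier_W r_coset_def using subgroup.m_closed[OF subgroup_N] by auto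

definition BNB :: "'a set" where
  "BNB = {b1 \<otimes> n \<otimes> b2 | b1 n b2. b1 \<in> B \<and> n \<in> N \<and> b2 \<in> B}"

lemma set_mult_BNB: "w \<subseteq> N \<Longrightarrow> B <#> w <#> B \<subseteq> BNB"
  unfolding set_mult_def BNB_def by blast

text \<open>(BN1) places \<open>n \<otimes> b1 \<otimes> m\<close> in one of two double cosets, both
  inside \<open>BNB\<close>; the remaining factor \<open>b2\<close> is absorbed on the
  right.\<close>

lemma mult_simple_reflection_BNB:
  assumes "s \<in> carrier W" and BN1: "\<And>w. w \<in> carrier W \<Longrightarrow>
      s <#> B <#> w \<subseteq> (B <#> (s \<otimes>\<^bsub>W\<^esub> w) <#> B) \<union> (B <#> w <#> B)"
    and n: "n \<in> s" and x: "x \<in> BNB"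
  shows "n \<otimes> x \<in> BNB"
proof -
  obtain b1 m b2 where x_eq: "x = b1 \<otimes> m \<otimes> b2" and b: "b1 \<in> B" "m \<in> N" "b2 \<in> B"
    using x by (auto simp: BNB_def)
  let ?w = "T #> m"
  have w: "?w \<in> carrier W" using b by (simp add: carrier_W)
  have nG: "n \<in> carrier G" using n assms(1) coset_subset_N N_carrier by blast
  have "n \<otimes> b1 \<otimes> m \<in> s <#> B <#> ?w"
    using n b mem_coset unfolding set_mult_def by blast
  also have "\<dots> \<subseteq> (B <#> (s \<otimes>\<^bsub>W\<^esub> ?w) <#> B) \<union> (B <#> ?w <#> B)" using w by (rule BN1)
  also have "\<dots> \<subseteq> BNB"
    using set_mult_BNB coset_subset_N w assms(1) monoid.m_closed[OF group.is_monoid[OF group_W]] by blast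
  finally obtain c1 k c2 where c: "n \<otimes> b1 \<otimes> m = c1 \<otimes> k \<otimes> c2" "c1 \<in> B" "k \<in> N" "c2 \<in> B"
    unfolding BNB_def by blast
  have "n \<otimes> x = n \<otimes> b1 \<otimes> m \<otimes> b2"
    using nG b B_carrier N_carrier by (simp add: x_eq m_assoc)
  also have "\<dots> = c1 \<otimes> k \<otimes> (c2 \<otimes> b2)"
    using c b B_carrier N_carrier by (simp add: m_assoc)
  finally show ?thesis
    using c b subgroup.m_closed[OF subgroup_B] unfolding BNB_def by blast
qed

lemma B_mult_BNB:
  assumes "b \<in> B" "x \<in> BNB" shows "b \<otimes> x \<in> BNB"
proof -
  obtain b1 m b2 where "x = b1 \<otimes> m \<otimes> b2" "b1 \<in> B" "m \<in> N" "b2 \<in> B"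
    using assms by (auto simp: BNB_def)
  moreover from this have "b \<otimes> x = (b \<otimes> b1) \<otimes> m \<otimes> b2"
    using assms B_carrier N_carrier by (simp add: m_assoc)
  ultimately show ?thesis
    using assms subgroup.m_closed[OF subgroup_B] unfolding BNB_def by blast
qed

text \<open>\<open>BNB\<close> contains the identity and is stable under left multiplication by
  \<open>B\<close> and by \<open>N\<close>, which together generate the group. For \<open>N\<close>,
  stability passes from the simple reflections to the whole finite Weyl group.\<close>

lemma bruhat_decomposition:
  assumes fin: "finite (carrier W)"
  shows "carrier G = BNB"
proof -
  obtain S where S: "S \<subseteq> carrier W" "generate W S = carrier W"
    and BN1: "\<And>s w. s \<in> S \<Longrightarrow> w \<in> carrier W \<Longrightarrow>
      s <#> B <#> w \<subseteq> (B <#> (s \<otimes>\<^bsub>W\<^esub> w) <#> B) \<union> (B <#> w <#> B)"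
    using BN unfolding BN_pair_def by blast
  have W_mult: "\<forall>n\<in>w. \<forall>x\<in>BNB. n \<otimes> x \<in> BNB" if "w \<in> carrier W" for w
  proof (rule group.generate_closed_if_finite[OF group_W fin S(1),
        where P = "\<lambda>w. \<forall>n\<in>w. \<forall>x\<in>BNB. n \<otimes> x \<in> BNB"])
    show "w \<in> generate W S" using that S by simp
    show "\<forall>n\<in>\<one>\<^bsub>W\<^esub>. \<forall>x\<in>BNB. n \<otimes> x \<in> BNB" using B_mult_BNB by (simp add: one_W)
    show "\<forall>n\<in>s. \<forall>x\<in>BNB. n \<otimes> x \<in> BNB" if "s \<in> S" for s
      using mult_simple_reflection_BNB[OF _ BN1] that S(1) by blast
    have BNB_carrier: "x \<in> carrier G" if "x \<in> BNB" for x
      using that B_carrier N_carrier by (auto simp: BNB_def)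
    show "\<forall>n\<in>u \<otimes>\<^bsub>W\<^esub> v. \<forall>x\<in>BNB. n \<otimes> x \<in> BNB"
      if uv: "u \<in> carrier W" "v \<in> carrier W" and "\<forall>n\<in>u. \<forall>x\<in>BNB. n \<otimes> x \<in> BNB"
        "\<forall>n\<in>v. \<forall>x\<in>BNB. n \<otimes> x \<in> BNB" for u v
    proof (intro ballI)
      fix n x assume "n \<in> u \<otimes>\<^bsub>W\<^esub> v" and x: "x \<in> BNB"
      then obtain k l where "k \<in> u" "l \<in> v" "n = k \<otimes> l" by (auto simp: mult_W set_mult_def)
      moreover from this have "n \<otimes> x = k \<otimes> (l \<otimes> x)"
        using uv coset_subset_N N_carrier BNB_carrier[OF x] by (auto intro!: m_assoc)
      ultimately show "n \<otimes> x \<in> BNB" using that x by simp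
    qed
  qed
  have BN_mult: "g \<otimes> x \<in> BNB" if "g \<in> B \<union> N" "x \<in> BNB" for g x
    using that W_mult B_mult_BNB mem_coset carrier_W by blast
  have BN_inv: "inv g \<in> B \<union> N" if "g \<in> B \<union> N" for g
    using that subgroup.m_inv_closed[OF subgroup_B] subgroup.m_inv_closed[OF subgroup_N] by blast
  have BN_sub: "B \<union> N \<subseteq> carrier G" using B_carrier N_carrier by blast
  have "g \<otimes> x \<in> BNB" if "g \<in> generate G (B \<union> N)" "x \<in> BNB" for g x
    using that
  proof (induction arbitrary: x rule: generate.induct)
    case one
    then show ?case using B_mult_BNB subgroup.one_closed[OF subgroup_B] by blast
  next
    case (eng h k)
    have "x \<in> carrier G" using eng.prems B_carrier N_carrier by (auto simp: BNB_def)
    then have "h \<otimes> k \<otimes> x = h \<otimes> (k \<otimes> x)"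
      using eng.hyps generate_in_carrier[OF BN_sub] by (intro m_assoc) auto
    then show ?case using eng by simp
  qed (use BN_mult BN_inv in auto)
  moreover have "\<one> \<in> BNB"
    unfolding BNB_def using subgroup.one_closed[OF subgroup_B] subgroup.one_closed[OF subgroup_N]
    by (auto intro!: exI[of _ \<one>])
  ultimately have "g \<in> BNB" if "g \<in> carrier G" for g
    using that generate_BN r_one by metis
  then show ?thesis using B_carrier N_carrier by (auto simp: BNB_def)
qed

text \<open>Since \<open>T \<subseteq> B\<close>, all members of a coset in the Weyl group give the
  same double coset, so one representative for each coset suffices.\<close>

lemma finite_double_coset_representatives:
  assumes fin: "finite (carrier W)"
  shows "\<exists>R. finite R \<and> R \<subseteq> carrier G \<and>
    (\<forall>g\<in>carrier G. \<exists>b1\<in>B. \<exists>r\<in>R. \<exists>b2\<in>B. g = b1 \<otimes> r \<otimes> b2)"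
proof (intro exI conjI ballI)
  define rep where "rep w = (SOME n. n \<in> N \<and> T #> n = w)" for w
  have rep: "rep w \<in> N \<and> T #> rep w = w" if "w \<in> carrier W" for w
    unfolding rep_def by (rule someI_ex) (use that in \<open>auto simp: carrier_W\<close>)
  show "finite (rep ` carrier W)" using fin by simp
  show "rep ` carrier W \<subseteq> carrier G" using rep N_carrier by blast
  fix g assume "g \<in> carrier G"
  then obtain b1 n b2 where g: "g = b1 \<otimes> n \<otimes> b2" "b1 \<in> B" "n \<in> N" "b2 \<in> B"
    using bruhat_decomposition[OF fin] by (auto simp: BNB_def)
  have w: "T #> n \<in> carrier W" using g by (simp add: carrier_W)
  then obtain t where t: "t \<in> T" "n = t \<otimes> rep (T #> n)"
    using mem_coset[OF g(3)] rep[OF w] unfolding r_coset_def by blast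
  have "g = (b1 \<otimes> t) \<otimes> rep (T #> n) \<otimes> b2"
    using g t rep[OF w] B_carrier N_carrier by (metis IntD1 m_assoc m_closed)
  moreover have "b1 \<otimes> t \<in> B" using g t subgroup.m_closed[OF subgroup_B] by blast
  ultimately show "\<exists>b1\<in>B. \<exists>r\<in>rep ` carrier W. \<exists>b2\<in>B. g = b1 \<otimes> r \<otimes> b2" using g w by blast
qed

section \<open>Consequences of saturation\<close>

lemma mem_conjugate_coset:
  assumes n: "n \<in> N" and x: "x \<in> carrier G" and "inv n \<otimes> x \<otimes> n \<in> B"
  shows "x \<in> (T #> n) <#> B <#> set_inv (T #> n)"
proof -
  have nG: "n \<in> carrier G" using n by (rule N_carrier)
  have "x = n \<otimes> (inv n \<otimes> x \<otimes> n) \<otimes> inv n"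
    using x nG by (simp add: m_assoc) (simp flip: m_assoc)
  then show ?thesis
    using assms(3) mem_coset[OF n] unfolding set_mult_def SET_INV_def by blast
qed

text \<open>Elementwise form of saturation. It will be applied to an element of \<open>U\<close>
  that is central in the division algebra and hence fixed by all these conjugations.\<close>

lemma saturated_core:
  assumes sat: "saturated_BN_pair G B N" and x: "x \<in> carrier G" and "\<And>n. n \<in> N \<Longrightarrow> inv n \<otimes> x \<otimes> n \<in> B"
  shows "x \<in> T"
proof -
  have "x \<in> w <#> B <#> set_inv w" if "w \<in> carrier W" for w
    using that mem_conjugate_coset x assms(3) by (auto simp: carrier_W)
  then show ?thesis using sat unfolding saturated_BN_pair_def by blast
qed

text \<open>Here \<open>B = T\<close>, which \<open>N\<close> normalizes. The outer factors may come
  from different representatives \<open>n\<close> and \<open>m\<close> of \<open>w\<close>, but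
  these differ only by elements of \<open>T\<close>.\<close>

lemma conjugate_coset_saturated:
  assumes sat: "saturated_BN_pair G B N" and "B \<subseteq> N" and w: "w \<in> carrier W"
  shows "w <#> B <#> set_inv w \<subseteq> B"
proof -
  have BT: "B = T" using assms by blast
  show ?thesis
  proof
    fix x assume "x \<in> w <#> B <#> set_inv w"
    then obtain n b m where x: "n \<in> w" "b \<in> B" "m \<in> w" "x = n \<otimes> b \<otimes> inv m"
      unfolding set_mult_def SET_INV_def by blast
    obtain k where k: "k \<in> N" "w = T #> k" using w by (auto simp: carrier_W)
    obtain s t where st: "s \<in> T" "n = s \<otimes> k" "t \<in> T" "m = t \<otimes> k"
      using x k unfolding r_coset_def by blast
    have "k \<otimes> b \<otimes> inv k \<in> T"
      using normal.inv_op_closed2[OF T_normal, of k b] k x BT subgroup_N m_inv_consistent[OF subgroup_N]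
      by auto
    then have "s \<otimes> (k \<otimes> b \<otimes> inv k) \<otimes> inv t \<in> B"
      using st subgroup.m_closed[OF subgroup_B] subgroup.m_inv_closed[OF subgroup_B] by blast
    moreover have "x = s \<otimes> (k \<otimes> b \<otimes> inv k) \<otimes> inv t"
      using x st k B_carrier N_carrier by (simp add: inv_mult_group m_assoc)
    ultimately show "x \<in> B" by simp
  qed
qed

text \<open>No element of the Weyl group can satisfy (BN2), so \<open>S\<close> is empty and the
  Weyl group is trivial. Then \<open>N \<subseteq> B\<close>, and \<open>B\<close> alone generates
  the group.\<close>

lemma trivial_if_B_subset_N:
  assumes sat: "saturated_BN_pair G B N" and "B \<subseteq> N"
  shows "B = carrier G"
proof -
  obtain S where S: "S \<subseteq> carrier W" "generate W S = carrier W"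
    and BN2: "\<And>s. s \<in> S \<Longrightarrow> \<not> s <#> B <#> set_inv s \<subseteq> B"
    using BN unfolding BN_pair_def by blast
  have "S = {}" using BN2 conjugate_coset_saturated[OF sat \<open>B \<subseteq> N\<close>] S(1) by blast
  then have "carrier W = {T}"
    using S group.generate_empty[OF group_W] by (simp add: one_W)
  then have "N \<subseteq> B" using mem_coset carrier_W by blast
  then have "generate G (B \<union> N) = B"
    using generate_subgroup_incl[OF _ subgroup_B] generate.incl[of _ "B \<union> N" G] by blast
  then show ?thesis using generate_BN by simp
qed

end

section \<open>Commuting conjugates\<close>

text \<open>Synthetic division as an identity between values at points of \<open>R\<close>. The
  quotient coefficients \<open>b\<close> commute with \<open>R\<close> again and keep the leading
  coefficient, so that the division can be repeated.\<close>

lemma divide_linear_factor: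
  fixes c :: "nat \<Rightarrow> 'd::ring_1"
  assumes R: "\<And>r s. r \<in> R \<Longrightarrow> s \<in> R \<Longrightarrow> r * s = s * r"
    and c: "\<And>i r. r \<in> R \<Longrightarrow> c i * r = r * c i"
    and r0: "r0 \<in> R"
  shows "\<exists>b e. b m = c (Suc m) \<and> (\<forall>i. \<forall>r\<in>R. b i * r = r * b i) \<and> (\<forall>r\<in>R. e * r = r * e) \<and>
    (\<forall>r\<in>R. (\<Sum>i\<le>Suc m. c i * r ^ i) = (r - r0) * (\<Sum>i\<le>m. b i * r ^ i) + e)"
  using c
proof (induction m arbitrary: c)
  case 0
  have "(\<Sum>i\<le>Suc 0. c i * r ^ i) = (r - r0) * (\<Sum>i\<le>0. c (Suc 0) * r ^ i) + (c 0 + r0 * c (Suc 0))"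
    if "r \<in> R" for r
    using 0[OF that, of "Suc 0"] by (simp add: algebra_simps)
  moreover have "(c 0 + r0 * c (Suc 0)) * r = r * (c 0 + r0 * c (Suc 0))" if "r \<in> R" for r
    using 0[OF that] R[OF that r0] by (simp add: distrib_left distrib_right) (metis mult.assoc)
  ultimately show ?case
    using 0 by (intro exI[of _ "\<lambda>_. c (Suc 0)"] exI[of _ "c 0 + r0 * c (Suc 0)"]) blast
next
  case (Suc m)
  obtain b e where b: "b m = c (Suc (Suc m))" "\<And>i r. r \<in> R \<Longrightarrow> b i * r = r * b i"
    and e: "\<And>r. r \<in> R \<Longrightarrow> e * r = r * e"
    and eq: "\<And>r. r \<in> R \<Longrightarrow> (\<Sum>i\<le>Suc m. c (Suc i) * r ^ i) = (r - r0) * (\<Sum>i\<le>m. b i * r ^ i) + e"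
    using Suc.IH[of "\<lambda>i. c (Suc i)"] Suc.prems by blast
  \<comment> \<open>Horner's scheme: the remainder \<open>e\<close> for the shifted coefficients
    becomes the constant coefficient of the quotient, and \<open>c 0 + r0 * e\<close> is the new
    remainder.\<close>
  define b' where "b' i = (case i of 0 \<Rightarrow> e | Suc j \<Rightarrow> b j)" for i
  have "(\<Sum>i\<le>Suc (Suc m). c i * r ^ i) = (r - r0) * (\<Sum>i\<le>Suc m. b' i * r ^ i) + (c 0 + r0 * e)"
    if r: "r \<in> R" for r
  proof -
    have "(\<Sum>i\<le>Suc (Suc m). c i * r ^ i) = c 0 + (\<Sum>i\<le>Suc m. c (Suc i) * r ^ i) * r"
      by (subst sum.atMost_Suc_shift) (simp add: sum_distrib_right mult.assoc power_commutes del: sum.atMost_Suc)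
    also have "\<dots> = (r - r0) * ((\<Sum>i\<le>m. b i * r ^ i) * r) + e * r + c 0"
      unfolding eq[OF r] by (simp add: distrib_right mult.assoc)
    also have "e * r = (r - r0) * e + r0 * e" using e[OF r] by (simp add: left_diff_distrib)
    also have "(\<Sum>i\<le>m. b i * r ^ i) * r = (\<Sum>i\<le>m. b i * r ^ Suc i)"
      by (simp add: sum_distrib_right mult.assoc power_commutes)
    also have "(r - r0) * (\<Sum>i\<le>m. b i * r ^ Suc i) + ((r - r0) * e + r0 * e) + c 0 =
        (r - r0) * (e + (\<Sum>i\<le>m. b i * r ^ Suc i)) + (c 0 + r0 * e)"
      by (simp add: distrib_left)
    also have "e + (\<Sum>i\<le>m. b i * r ^ Suc i) = (\<Sum>i\<le>Suc m. b' i * r ^ i)"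
      by (subst sum.atMost_Suc_shift) (simp add: b'_def)
    finally show ?thesis .
  qed
  moreover have "(c 0 + r0 * e) * r = r * (c 0 + r0 * e)" if "r \<in> R" for r
    using Suc.prems[OF that] e[OF that] R[OF that r0]
    by (simp add: distrib_left distrib_right) (metis mult.assoc)
  moreover have "b' i * r = r * b' i" if "r \<in> R" for i r
    using b(2)[OF that] e[OF that] by (simp add: b'_def split: nat.split)
  moreover have "b' (Suc m) = c (Suc (Suc m))" using b(1) by (simp add: b'_def)
  ultimately show ?case by (intro exI[of _ b'] exI[of _ "c 0 + r0 * e"]) blast
qed

text \<open>Over a division ring a nonzero polynomial can have infinitely many roots, as
  \<open>X ^ 2 + 1\<close> has over the quaternions. Among commuting candidates the usual induction
  works: split off one root and lower the degree.\<close>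

lemma finite_commuting_roots:
  fixes c :: "nat \<Rightarrow> 'd::division_ring"
  assumes R: "\<And>r s. r \<in> R \<Longrightarrow> s \<in> R \<Longrightarrow> r * s = s * r"
    and c: "\<And>i r. r \<in> R \<Longrightarrow> c i * r = r * c i" and lead: "c m \<noteq> 0"
  shows "finite {r \<in> R. (\<Sum>i\<le>m. c i * r ^ i) = 0}"
  using c lead
proof (induction m arbitrary: c)
  case (Suc m)
  show ?case
  proof (cases "{r \<in> R. (\<Sum>i\<le>Suc m. c i * r ^ i) = 0} = {}")
    case False
    then obtain r0 where r0: "r0 \<in> R" "(\<Sum>i\<le>Suc m. c i * r0 ^ i) = 0" by blast
    obtain b e where b: "b m = c (Suc m)" "\<And>i r. r \<in> R \<Longrightarrow> b i * r = r * b i"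
      and eq: "\<And>r. r \<in> R \<Longrightarrow> (\<Sum>i\<le>Suc m. c i * r ^ i) = (r - r0) * (\<Sum>i\<le>m. b i * r ^ i) + e"
      using divide_linear_factor[of R c r0 m] R Suc.prems(1) r0(1) by blast
    have "e = 0" using eq[OF r0(1)] r0(2) by simp
    then have "{r \<in> R. (\<Sum>i\<le>Suc m. c i * r ^ i) = 0} \<subseteq> insert r0 {r \<in> R. (\<Sum>i\<le>m. b i * r ^ i) = 0}"
      using eq by auto
    moreover have "finite {r \<in> R. (\<Sum>i\<le>m. b i * r ^ i) = 0}"
      using Suc.IH[of b] b Suc.prems(2) by simp
    ultimately show ?thesis by (meson finite_insert finite_subset)
  qed (simp only: finite.emptyI)
qed simp

context fin_dim_division_algebra
begin

text \<open>Finite dimension forces a linear relation between powers of \<open>a\<close>, which is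
  then cut off at its highest nonzero coefficient.\<close>

lemma algebraic:
  fixes a :: 'd
  obtains c :: "nat \<Rightarrow> 'k" and m where "c m \<noteq> 0" "(\<Sum>i\<le>m. scale (c i) 1 * a ^ i) = 0"
proof -
  have "\<exists>c::nat \<Rightarrow> 'k. \<exists>m. (\<exists>i\<le>m. c i \<noteq> 0) \<and> (\<Sum>i\<le>m. scale (c i) (a ^ i)) = 0"
  \<comment> \<open>Linear dependence is a property of sets, in which equal powers would collapse; a
    repetition of powers gives a relation directly.\<close>
  proof (cases "inj (\<lambda>i::nat. a ^ i)")
    case True
    obtain F where F: "finite F" "span F = UNIV" using finite_dim by blast
    have "infinite (range (\<lambda>i::nat. a ^ i))" using True by (simp add: finite_image_iff)
    then have "dependent (range (\<lambda>i::nat. a ^ i))"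
      using independent_span_bound[OF F(1)] F(2) by auto
    then obtain T u where T: "finite T" "T \<subseteq> range (\<lambda>i::nat. a ^ i)" "(\<Sum>v\<in>T. scale (u v) v) = 0"
      and u: "\<exists>v\<in>T. u v \<noteq> 0"
      unfolding dependent_explicit by blast
    obtain I where I: "finite I" "T = (\<lambda>i. a ^ i) ` I" using T finite_subset_image by meson
    have inj: "inj_on (\<lambda>i. a ^ i) I" using True by (rule inj_on_subset) simp
    define c where "c i = (if i \<in> I then u (a ^ i) else 0)" for i
    have sub: "I \<subseteq> {..Max I}" using I by auto
    have "(\<Sum>i\<le>Max I. scale (c i) (a ^ i)) = (\<Sum>i\<in>I. scale (u (a ^ i)) (a ^ i))"
      by (rule sum.mono_neutral_cong_right) (use sub in \<open>auto simp: c_def\<close>)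
    also have "\<dots> = 0" using T(3) unfolding I(2) sum.reindex[OF inj] by simp
    finally have "(\<Sum>i\<le>Max I. scale (c i) (a ^ i)) = 0" .
    moreover have "\<exists>i\<le>Max I. c i \<noteq> 0" using u I sub by (auto simp: c_def)
    ultimately show ?thesis by blast
  next
    case False
    then obtain i j :: nat where ij: "a ^ i = a ^ j" "i < j"
      by (metis injI linorder_neqE_nat)
    define c :: "nat \<Rightarrow> 'k" where "c l = (if l = i then 1 else if l = j then - 1 else 0)" for l
    have "(\<Sum>l\<le>j. scale (c l) (a ^ l)) = (\<Sum>l\<in>{i, j}. scale (c l) (a ^ l))"
      by (rule sum.mono_neutral_cong_right) (use ij in \<open>auto simp: c_def\<close>)
    also have "\<dots> = 0" using ij by (simp add: c_def)
    finally have "(\<Sum>l\<le>j. scale (c l) (a ^ l)) = 0" .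
    moreover have "\<exists>l\<le>j. c l \<noteq> 0" using ij by (auto simp: c_def)
    ultimately show ?thesis by blast
  qed
  then obtain c :: "nat \<Rightarrow> 'k" and m where cm: "\<exists>i\<le>m. c i \<noteq> 0" "(\<Sum>i\<le>m. scale (c i) (a ^ i)) = 0"
    by blast
  define k where "k = Max {i. i \<le> m \<and> c i \<noteq> 0}"
  have fin: "finite {i. i \<le> m \<and> c i \<noteq> 0}" by simp
  have k: "k \<le> m" "c k \<noteq> 0" using Max_in[OF fin] cm(1) unfolding k_def by auto
  have "c i = 0" if "k < i" "i \<le> m" for i
  proof (rule ccontr)
    assume "c i \<noteq> 0"
    then have "i \<le> k" unfolding k_def by (intro Max_ge[OF fin]) (use that in simp)
    then show False using that by simp
  qed
  then have "(\<Sum>i\<le>m. scale (c i) (a ^ i)) = (\<Sum>i\<le>k. scale (c i) (a ^ i))"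
    by (intro sum.mono_neutral_right) (use k in auto)
  then show thesis using that[of c k] k cm(2) by (simp add: scale_mult_left)
qed

text \<open>All these conjugates are roots of the polynomial over \<open>k\<close> that annihilates
  \<open>a\<close>, since its coefficients \<open>scale (c i) 1\<close> are central; being commuting
  roots, they are finite in number.\<close>

lemma finite_commuting_conjugates:
  fixes a :: 'd
  assumes "\<And>b. b \<in> B \<Longrightarrow> b \<noteq> 0"
    and comm: "\<And>b b'. b \<in> B \<Longrightarrow> b' \<in> B \<Longrightarrow>
      (b * a * inverse b) * (b' * a * inverse b') = (b' * a * inverse b') * (b * a * inverse b)"
  shows "finite ((\<lambda>b. b * a * inverse b) ` B)"
proof -
  let ?R = "(\<lambda>b. b * a * inverse b) ` B"
  obtain c :: "nat \<Rightarrow> 'k" and m where c: "c m \<noteq> 0" "(\<Sum>i\<le>m. scale (c i) 1 * a ^ i) = 0"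
    by (rule algebraic)
  have pow: "(b * a * inverse b) ^ i = b * a ^ i * inverse b" if "b \<noteq> 0" for b i
  proof (induction i)
    case (Suc i)
    have "(b * a * inverse b) ^ Suc i = b * a * (inverse b * b) * a ^ i * inverse b"
      unfolding power_Suc Suc by (simp only: mult.assoc)
    also have "\<dots> = b * a ^ Suc i * inverse b" using that by (simp add: mult.assoc)
    finally show ?case .
  qed (use that in simp)
  have "(\<Sum>i\<le>m. scale (c i) 1 * r ^ i) = 0" if "r \<in> ?R" for r
  proof -
    from that obtain b where b: "r = b * a * inverse b" "b \<in> B" by (rule imageE)
    then have b0: "b \<noteq> 0" using assms(1) by simp
    have "(\<Sum>i\<le>m. scale (c i) 1 * r ^ i) = b * (\<Sum>i\<le>m. scale (c i) 1 * a ^ i) * inverse b"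
      unfolding b(1) pow[OF b0]
      by (simp add: sum_distrib_left sum_distrib_right scale_mult_left scale_mult_right)
    then show ?thesis using c by simp
  qed
  then have "?R = {r \<in> ?R. (\<Sum>i\<le>m. scale (c i) 1 * r ^ i) = 0}" by blast
  moreover have "finite {r \<in> ?R. (\<Sum>i\<le>m. scale (c i) 1 * r ^ i) = 0}"
  proof (rule finite_commuting_roots)
    show "scale (c m) 1 \<noteq> 0" using c(1) by simp
    show "r * s = s * r" if "r \<in> ?R" "s \<in> ?R" for r s using that comm by blast
  qed (simp add: scale_mult_left scale_mult_right)
  ultimately show ?thesis by simp
qed

end

section \<open>Norms of differences of conjugates\<close>

context fin_dim_division_algebra
begin

text \<open>\<open>M x\<close> is the matrix of left multiplication by \<open>x\<close> in a
  \<open>k\<close>-basis. The last clause states linearity along lines, the form in which it turns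
  norms into polynomials in \<open>t\<close>.\<close>

lemma exists_left_regular_representation:
  obtains M :: "'d \<Rightarrow> 'k mat" and n where "n > 0" "\<And>x. M x \<in> carrier_mat n n"
    "\<And>x y. M (x * y) = M x * M y" "M 1 = 1\<^sub>m n" "\<And>x y t. M (x + scale t y) = M x + t \<cdot>\<^sub>m M y"
proof -
  obtain F where F: "finite F" "span F = UNIV" using finite_dim by blast
  obtain E where E: "E \<subseteq> F" "independent E" "F \<subseteq> span E"
    using maximal_independent_subset[of F] by blast
  have spE: "span E = UNIV"
    using span_mono[OF E(3)] F(2) by (simp add: span_span top.extremum_uniqueI)
  have finE: "finite E" using E F by (blast intro: finite_subset)
  define n where "n = card E"
  obtain e where e: "bij_betw e {..<n} E"
    using ex_bij_betw_nat_finite[OF finE] unfolding n_def atLeast0LessThan by blast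
  define r where "r v i = representation E v (e i)" for v i
  define M where "M x = mat n n (\<lambda>(i, j). r (x * e j) i)" for x
  have r_sum: "r (sum f A) i = (\<Sum>a\<in>A. r (f a) i)" for f :: "nat \<Rightarrow> 'd" and A i
    unfolding r_def using representation_sum[OF E(2), of A f] spE by simp
  have r_add: "r (v + w) i = r v i + r w i" for v w i
    unfolding r_def using representation_add[OF E(2)] spE by simp
  have r_scale: "r (scale t v) i = t * r v i" for t v i
    unfolding r_def using representation_scale[OF E(2)] spE by simp
  have r_basis: "r (e j) i = (if i = j then 1 else 0)" if "i < n" "j < n" for i j
    using e that representation_basis[OF E(2), of "e j"]
    by (auto simp: r_def bij_betw_def inj_on_def)
  have expand: "(\<Sum>l<n. scale (r v l) (e l)) = v" for v
  proof -
    have "(\<Sum>b\<in>E. scale (representation E v b) b) = v"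
      by (rule sum_representation_eq) (use E finE spE in auto)
    then show ?thesis unfolding r_def by (subst (asm) sum.reindex_bij_betw[OF e, symmetric])
  qed
  show thesis
  proof (rule that[of n M])
    have "E \<noteq> {}"
    proof
      assume "E = {}"
      then have "(1::'d) \<in> {0}" using spE by (metis UNIV_I span_empty)
      then show False by simp
    qed
    then show "n > 0" unfolding n_def using finE by (simp add: card_gt_0_iff)
    show "M x \<in> carrier_mat n n" for x by (simp add: M_def)
    show "M 1 = 1\<^sub>m n" by (rule eq_matI) (auto simp: M_def r_basis)
    show "M (x + scale t y) = M x + t \<cdot>\<^sub>m M y" for x y t
      by (rule eq_matI) (auto simp: M_def distrib_right r_add scale_mult_left r_scale)
    show "M (x * y) = M x * M y" for x y
    proof (rule eq_matI)
      fix i j assume ij: "i < dim_row (M x * M y)" "j < dim_col (M x * M y)"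
      then have ij: "i < n" "j < n" by (auto simp: M_def)
      have "x * y * e j = x * (\<Sum>l<n. scale (r (y * e j) l) (e l))"
        by (simp add: expand mult.assoc)
      also have "\<dots> = (\<Sum>l<n. scale (r (y * e j) l) (x * e l))"
        by (simp add: sum_distrib_left scale_mult_right)
      finally have "r (x * y * e j) i = (\<Sum>l<n. r (x * e l) i * r (y * e j) l)"
        by (simp add: r_sum r_scale mult.commute)
      then show "M (x * y) $$ (i, j) = (M x * M y) $$ (i, j)"
        using ij by (simp add: M_def scalar_prod_def atLeast0LessThan)
    qed (auto simp: M_def)
  qed
qed

text \<open>\<open>nr\<close> is the determinant of left multiplication on \<open>D\<close> over
  \<open>k\<close>, not the reduced norm. Along \<open>x + t\<close> it is the characteristic
  polynomial of \<open>- M x\<close>, hence of exact degree \<open>n\<close>; along other lines it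
  is the determinant of a matrix of linear polynomials, which only bounds the degree.\<close>

lemma exists_algebra_norm:
  obtains nr :: "'d \<Rightarrow> 'k" and n where "n > 0" "\<And>x y. nr (x * y) = nr x * nr y" "nr 1 = 1" "nr 0 = 0"
    "\<And>x. \<exists>p. degree p = n \<and> (\<forall>t. poly p t = nr (x + scale t 1))"
    "\<And>x y. \<exists>p. degree p \<le> n \<and> (\<forall>t. poly p t = nr (x + scale t y))"
proof -
  obtain M :: "'d \<Rightarrow> 'k mat" and n where n: "n > 0" and M: "\<And>x. M x \<in> carrier_mat n n"
    and M_mult: "\<And>x y. M (x * y) = M x * M y" and M_one: "M 1 = 1\<^sub>m n"
    and M_lin: "\<And>x y t. M (x + scale t y) = M x + t \<cdot>\<^sub>m M y"
    by (rule exists_left_regular_representation) blast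
  have dims: "dim_row (M x) = n" "dim_col (M x) = n" for x using M[of x] by auto
  show thesis
  proof (rule that[of n "\<lambda>x. det (M x)"])
    show "det (M (x * y)) = det (M x) * det (M y)" for x y
      unfolding M_mult by (rule det_mult) (rule M)+
    show "det (M 1) = 1" by (simp add: M_one)
    \<comment> \<open>Writing 0 as \<open>1 + scale (-1) 1\<close> lets the linearity clause compute
      \<open>M 0\<close>.\<close>
    have "M (1 + scale (-1) 1) = 1\<^sub>m n + (-1) \<cdot>\<^sub>m 1\<^sub>m n" unfolding M_lin M_one ..
    also have "\<dots> = 0\<^sub>m n n" by (rule eq_matI) auto
    finally have "M 0 = 0\<^sub>m n n" by simp
    then show "det (M 0) = 0" using n by simp
    show "\<exists>p. degree p \<le> n \<and> (\<forall>t. poly p t = det (M (x + scale t y)))" for x y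
    proof (intro exI conjI allI)
      let ?P = "mat n n (\<lambda>(i, j). [:M x $$ (i, j), M y $$ (i, j):])"
      show "degree (det ?P) \<le> n"
        using degree_det_le[of n ?P 1] by simp
      show "poly (det ?P) t = det (M (x + scale t y))" for t
        by (rule poly_det_cong[of _ n]) (use dims M in \<open>auto simp: M_lin\<close>)
    qed
    show "\<exists>p. degree p = n \<and> (\<forall>t. poly p t = det (M (x + scale t 1)))" for x
    proof (intro exI conjI allI)
      have "- M x \<in> carrier_mat n n" using M by simp
      then show "degree (char_poly (- M x)) = n" using degree_monic_char_poly by blast
      show "poly (char_poly (- M x)) t = det (M (x + scale t 1))" for t
        unfolding char_poly_def
        by (rule poly_det_cong[of _ n]) (use dims M in \<open>auto simp: M_lin M_one char_poly_matrix_def\<close>)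
    qed
  qed (rule n)
qed

lemma scale_one_commute: "scale t 1 * x = x * scale t 1"
  by (simp add: scale_mult_left scale_mult_right)

text \<open>
  For \<open>p = x + t\<close> and \<open>g = p a p\<^sup>-\<^sup>1 a\<^sup>-\<^sup>1\<close>, the identity \<open>key\<close> gives
  \<open>nr(p)\<^sup>2 nr(a - g a g\<^sup>-\<^sup>1) nr(a) = nr(y) nr(y - p d)\<close> with \<open>y\<close> and \<open>d\<close> independent of \<open>t\<close>. If
  \<open>nr(a - g a g\<^sup>-\<^sup>1)\<close> is the same nonzero scalar for infinitely many \<open>t\<close>, the left side has degree \<open>2n\<close> in
  \<open>t\<close>, but the right side has degree at most \<open>n\<close>.
\<close>
lemma central_if_finitely_many_norms:
  fixes nr :: "'d \<Rightarrow> 'k"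
  assumes inf: "infinite (UNIV :: 'k set)"
    and n: "n > 0" and mult: "\<And>x y. nr (x * y) = nr x * nr y" and one: "nr 1 = 1" and zero: "nr 0 = 0"
    and monic: "\<And>x. \<exists>p. degree p = n \<and> (\<forall>t. poly p t = nr (x + scale t 1))"
    and lin: "\<And>x y. \<exists>p. degree p \<le> n \<and> (\<forall>t. poly p t = nr (x + scale t y))"
    and a: "a \<noteq> 0"
    and fin: "finite {nr (a - g * a * inverse g) | g p. p \<noteq> 0 \<and> g = p * a * inverse p * inverse a}"
  shows "a * x = x * a"
proof (rule ccontr)
  assume noncomm: "a * x \<noteq> x * a"
  \<comment> \<open>Scalars are central, so \<open>y\<close> is also the commutator
    \<open>a * p t - p t * a\<close> for every \<open>t\<close>.\<close>
  define y where "y = a * x - x * a"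
  define d where "d = inverse y * (a * y - y * a)"
  define p where "p t = x + scale t 1" for t
  define g where "g t = p t * a * inverse (p t) * inverse a" for t
  define v where "v t = nr (a - g t * a * inverse (g t))" for t
  have y0: "y \<noteq> 0" using noncomm by (simp add: y_def)
  have py: "a * p t - p t * a = y" for t
    by (simp add: p_def y_def algebra_simps scale_one_commute)
  have p0: "p t \<noteq> 0" for t using py[of t] y0 by auto
  have nr0: "nr z \<noteq> 0" if "z \<noteq> 0" for z
    using mult[of z "inverse z"] one that by auto
  \<comment> \<open>With \<open>b = p a p^-1 = g a\<close>, the product
    \<open>(a - g a g^-1) g a\<close> is \<open>a b - b a\<close>. Multiplying by \<open>p\<close>
    on the right and using \<open>a p = p a + y\<close> leaves
    \<open>y p^-1 y - (a y - y a)\<close>. The left factor \<open>p y^-1\<close> then clears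
    \<open>p^-1\<close>, so the result is affine in \<open>t\<close>.\<close>
  have key: "p t * inverse y * (a - g t * a * inverse (g t)) * g t * a * p t = y - p t * d" for t
  proof -
    let ?p = "p t" and ?q = "inverse (p t)"
    have gt: "g t \<noteq> 0" using p0[of t] a by (simp add: g_def)
    have ap: "a * ?p = ?p * a + y" using py[of t] by (simp add: algebra_simps)
    have qq: "?q * ?p = 1" "?p * ?q = 1" using p0[of t] by simp_all
    have ga: "g t * a = ?p * a * ?q" using a by (simp add: g_def mult.assoc)
    have "(a - g t * a * inverse (g t)) * g t = a * g t - g t * a * (inverse (g t) * g t)"
      by (simp only: left_diff_distrib mult.assoc)
    also have "\<dots> = a * g t - g t * a" using gt by simp
    finally have "(a - g t * a * inverse (g t)) * g t * a = a * (g t * a) - g t * a * a"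
      by (simp only: left_diff_distrib mult.assoc)
    then have "(a - g t * a * inverse (g t)) * g t * a = a * (?p * a * ?q) - ?p * a * ?q * a"
      unfolding ga .
    moreover have "(a * (?p * a * ?q) - ?p * a * ?q * a) * ?p = y * ?q * y - (a * y - y * a)"
    proof -
      let ?b = "?p * a * ?q"
      have bp: "?b * ?p = ?p * a" using qq by (simp add: mult.assoc)
      have "?p * a = a * ?p - y" using ap by simp
      then have "?b * y = (a * ?p - y) * ?q * y" by simp
      also have "\<dots> = a * (?p * ?q) * y - y * ?q * y" by (simp only: left_diff_distrib mult.assoc)
      finally have by': "?b * y = a * y - y * ?q * y" using qq by simp
      have "(a * ?b - ?b * a) * ?p = a * (?b * ?p) - ?b * (a * ?p)"
        by (simp only: left_diff_distrib mult.assoc)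
      also have "?b * (a * ?p) = (?b * ?p) * a + ?b * y"
        unfolding ap by (simp only: distrib_left mult.assoc)
      also have "a * (?b * ?p) - \<dots> = (a * ?p - ?p * a) * a - ?b * y"
        unfolding bp by (simp add: left_diff_distrib mult.assoc)
      also have "\<dots> = y * a - ?b * y" using ap by simp
      finally show ?thesis unfolding by' by simp
    qed
    ultimately have "p t * inverse y * (a - g t * a * inverse (g t)) * g t * a * p t =
        ?p * inverse y * (y * ?q * y - (a * y - y * a))"
      by (simp add: mult.assoc)
    also have "\<dots> = ?p * (inverse y * y) * ?q * y - ?p * d"
      unfolding d_def by (simp only: right_diff_distrib mult.assoc)
    also have "\<dots> = y - ?p * d" using y0 qq by simp
    finally show ?thesis .
  qed
  have nr_g: "nr (g t) = 1" for t
  proof -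
    have "nr (g t) = nr (p t) * nr (inverse (p t)) * (nr a * nr (inverse a))"
      unfolding g_def mult by (simp add: ac_simps)
    then show ?thesis using p0[of t] a by (simp flip: mult add: one)
  qed
  have nr_key: "nr (p t) ^ 2 * (v t * nr a) = nr y * nr (y - p t * d)" for t
  proof -
    have 1: "nr (p t) * nr (inverse y) * v t * nr (g t) * nr a * nr (p t) = nr (y - p t * d)"
      using arg_cong[OF key, of nr t] unfolding mult v_def .
    have "nr y * nr (inverse y) = 1" using y0 by (simp flip: mult add: one)
    then have "nr (p t) ^ 2 * (v t * nr a) = (nr y * nr (inverse y)) * (nr (p t) ^ 2 * (v t * nr a))"
      by simp
    also have "\<dots> = nr y * (nr (p t) * nr (inverse y) * v t * nr (g t) * nr a * nr (p t))"
      unfolding nr_g power2_eq_square by (simp only: ac_simps mult_1)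
    finally show ?thesis unfolding 1 .
  qed
  have "range v \<subseteq> {nr (a - g * a * inverse g) | g p. p \<noteq> 0 \<and> g = p * a * inverse p * inverse a}"
    unfolding v_def g_def using p0 by blast
  then have "finite (range v)" using fin by (rule finite_subset)
  \<comment> \<open>Finitely many values over an infinite field: one value \<open>c\<close> recurs
    infinitely often, which turns \<open>nr_key\<close> into an identity of polynomials in
    \<open>t\<close>.\<close>
  then obtain c where c: "infinite {t. v t = c}"
    using inf_img_fin_dom[of v UNIV] inf by (auto simp: vimage_def)
  obtain P where P: "degree P = n" "\<And>t. poly P t = nr (p t)" using monic[of x] unfolding p_def by blast
  obtain R where R: "degree R \<le> n" "\<And>t. poly R t = nr ((y - x * d) + scale t (- d))"
    using lin[of "y - x * d" "- d"] by blast
  have R': "poly R t = nr (y - p t * d)" for t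
  proof -
    have "(y - x * d) + scale t (- d) = y - p t * d"
      by (simp add: p_def distrib_right scale_mult_left)
    then show ?thesis unfolding R(2) by (simp only:)
  qed
  let ?L = "smult (c * nr a) (P ^ 2) - smult (nr y) R"
  have "{t. v t = c} \<subseteq> {t. poly ?L t = 0}"
    using nr_key by (auto simp: P R' ac_simps)
  then have L0: "?L = 0" using c poly_roots_finite[of ?L] by (meson infinite_super)
  have "c = 0"
  proof (rule ccontr)
    assume "c \<noteq> 0"
    moreover have "P \<noteq> 0" using P n by auto
    ultimately have "degree (smult (c * nr a) (P ^ 2)) = 2 * n"
      using P n nr0[OF a] by (simp add: degree_power_eq)
    moreover have "smult (c * nr a) (P ^ 2) = smult (nr y) R" using L0 by simp
    ultimately have "degree (smult (nr y) R) = 2 * n" by metis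
    then show False using n R(1) degree_smult_le[of "nr y" R] by linarith
  qed
  \<comment> \<open>For \<open>c = 0\<close> the polynomial \<open>R\<close> vanishes, so
    \<open>y - p t * d\<close> has norm 0 for every \<open>t\<close>. Comparing \<open>t = 0\<close>
    with \<open>t = 1\<close> then gives \<open>d = 0\<close> and \<open>y = 0\<close>.\<close>
  have "y = p t * d" for t
  proof -
    have "smult (nr y) R = 0" using L0 \<open>c = 0\<close> by simp
    then have "poly (smult (nr y) R) t = 0" by (metis poly_0)
    then have "nr (y - p t * d) = 0" using nr0[OF y0] by (simp add: R')
    then show ?thesis using nr0 by force
  qed
  from this[of 0] this[of 1] have "y = x * d" "y = x * d + d"
    by (simp_all add: p_def distrib_right)
  then show False using y0 by auto
qed

end

section \<open>Finite ground fields, reduced norms of commutators, and double cosets\<close>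

lemma (in fin_dim_division_algebra) finite_UNIV_if_finite_scalars:
  assumes "finite (UNIV :: 'k set)" shows "finite (UNIV :: 'd set)"
proof -
  obtain F where F: "finite F" "span F = UNIV" using finite_dim by blast
  have "UNIV \<subseteq> (\<lambda>u. \<Sum>v\<in>F. scale (u v) v) ` (F \<rightarrow>\<^sub>E UNIV)"
  proof
    fix x :: 'd
    have "x \<in> range (\<lambda>u. \<Sum>v\<in>F. scale (u v) v)"
      unfolding span_finite[OF F(1), symmetric] F(2) by simp
    then obtain u where "x = (\<Sum>v\<in>F. scale (u v) v)" by (rule rangeE)
    then have "x = (\<Sum>v\<in>F. scale (restrict u F v) v)" by (simp cong: sum.cong)
    then show "x \<in> (\<lambda>u. \<Sum>v\<in>F. scale (u v) v) ` (F \<rightarrow>\<^sub>E UNIV)"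
      by (intro image_eqI[of _ _ "restrict u F"]) simp_all
  qed
  moreover have "finite (F \<rightarrow>\<^sub>E (UNIV :: 'k set))" using F assms by (simp add: finite_PiE)
  ultimately show ?thesis by (meson finite_imageI finite_subset)
qed

text \<open>In every splitting the determinants lie in a field, so those of a commutator cancel.
  Thus the commutators used as test elements belong to \<open>SL1\<close> as well.\<close>

lemma (in fin_dim_division_algebra) reduced_norm_commutator:
  assumes "x \<noteq> 0" "y \<noteq> 0"
  shows "is_reduced_norm scale (x * y * inverse x * inverse y) 1"
  unfolding is_reduced_norm_def
proof (intro conjI allI impI)
  show "1 \<in> ring_center" by (simp add: ring_center_def)
  fix n \<iota> \<phi> assume "splitting scale n \<iota> \<phi>"
  then have carr: "\<And>x. \<phi> x \<in> carrier_mat n n" and one: "\<phi> 1 = 1\<^sub>m n"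
    and mult: "\<And>x y. \<phi> (x * y) = \<phi> x * \<phi> y" and \<iota>: "\<And>a. \<iota> (scale a 1) = to_ac a"
    unfolding splitting_def by blast+
  have det_mult: "det (\<phi> (x * y)) = det (\<phi> x) * det (\<phi> y)" for x y
    unfolding mult by (rule det_mult) (rule carr)+
  have det_inv: "det (\<phi> z) * det (\<phi> (inverse z)) = 1" if "z \<noteq> 0" for z
    using that one by (simp flip: det_mult)
  have "det (\<phi> (x * y * inverse x * inverse y)) =
      (det (\<phi> x) * det (\<phi> (inverse x))) * (det (\<phi> y) * det (\<phi> (inverse y)))"
    unfolding det_mult by (simp add: ac_simps)
  also have "\<dots> = \<iota> 1" using det_inv assms \<iota>[of 1] by simp
  finally show "det (\<phi> (x * y * inverse x * inverse y)) = \<iota> 1" .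
qed

text \<open>
  For \<open>g = b\<^sub>1 r b\<^sub>2\<close>, the element \<open>a - g a g\<^sup>-\<^sup>1\<close> is conjugate by \<open>b\<^sub>1\<close> to a difference of a
  \<open>B\<close>-conjugate of \<open>a\<close> and an \<open>r\<close>-conjugate of one.
\<close>
lemma finite_norms_of_double_cosets:
  fixes nr :: "'d::division_ring \<Rightarrow> 'k::field" and a :: 'd
  assumes mult: "\<And>x y. nr (x * y) = nr x * nr y" and one: "nr 1 = 1"
    and B: "\<And>b. b \<in> B \<Longrightarrow> b \<noteq> 0" "\<And>b. b \<in> B \<Longrightarrow> inverse b \<in> B"
    and fin: "finite R" "finite ((\<lambda>b. b * a * inverse b) ` B)" and R: "\<And>r. r \<in> R \<Longrightarrow> r \<noteq> 0"
    and dec: "\<And>g. g \<in> K \<Longrightarrow> \<exists>b1\<in>B. \<exists>r\<in>R. \<exists>b2\<in>B. g = b1 * r * b2"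
  shows "finite ((\<lambda>g. nr (a - g * a * inverse g)) ` K)"
proof (rule finite_subset)
  let ?C = "(\<lambda>b. b * a * inverse b) ` B"
  let ?f = "\<lambda>(c, r, c'). nr (c - r * c' * inverse r)"
  show "finite (?f ` (?C \<times> R \<times> ?C))" using fin by blast
  show "(\<lambda>g. nr (a - g * a * inverse g)) ` K \<subseteq> ?f ` (?C \<times> R \<times> ?C)"
  proof
    fix v assume "v \<in> (\<lambda>g. nr (a - g * a * inverse g)) ` K"
    then obtain g where g: "g \<in> K" "v = nr (a - g * a * inverse g)" by auto
    obtain b1 r b2 where b: "b1 \<in> B" "r \<in> R" "b2 \<in> B" "g = b1 * r * b2"
      using dec[OF g(1)] by blast
    have nz: "b1 \<noteq> 0" "r \<noteq> 0" "b2 \<noteq> 0" using b B(1) R by auto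
    define c where "c = inverse b1 * a * inverse (inverse b1)"
    define c' where "c' = b2 * a * inverse b2"
    have 1: "b1 * c * inverse b1 = a"
      using nz by (simp add: c_def mult.assoc) (simp flip: mult.assoc)
    have 2: "g * a * inverse g = b1 * (r * c' * inverse r) * inverse b1"
      using nz by (simp add: b(4) c'_def nonzero_inverse_mult_distrib mult.assoc)
    have "v = nr (b1 * c * inverse b1 - b1 * (r * c' * inverse r) * inverse b1)"
      unfolding g(2) 1 2 ..
    also have "b1 * c * inverse b1 - b1 * (r * c' * inverse r) * inverse b1 =
        b1 * (c - r * c' * inverse r) * inverse b1"
      by (simp only: left_diff_distrib right_diff_distrib)
    also have "nr \<dots> = nr (c - r * c' * inverse r) * (nr b1 * nr (inverse b1))"
      unfolding mult by (simp only: ac_simps)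
    also have "nr b1 * nr (inverse b1) = 1" using nz by (simp flip: mult add: one)
    finally have "v = ?f (c, r, c')" by simp
    moreover have "(c, r, c') \<in> ?C \<times> R \<times> ?C" unfolding c_def c'_def using b B(2) by (intro SigmaI imageI) auto
    ultimately show "v \<in> ?f ` (?C \<times> R \<times> ?C)" by (rule image_eqI)
  qed
qed

theorem corollary5p2:
  fixes scale :: "'k::field \<Rightarrow> 'd::division_ring \<Rightarrow> 'd"
    and H :: "'d monoid" and B N :: "'d set"
  assumes "fin_dim_division_algebra scale"
    and "H = mult_group \<or> H = SL1 scale"
    and "split_BN_pair H B N" and "spherical_BN_pair H B N"
  shows "B = carrier H"
proof -
  interpret D: fin_dim_division_algebra scale by (rule assms(1))
  have sat: "saturated_BN_pair H B N" using assms(3) by (simp add: split_BN_pair_def)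
  have BN: "BN_pair H B N" and fin: "finite (carrier (weyl_group H B N))"
    using assms(4) by (simp_all add: spherical_BN_pair_def)
  have "group H" using BN by (simp add: BN_pair_def)
  then interpret H: bn_pair H B N by (simp add: bn_pair_def bn_pair_axioms_def BN)
  have H_mult: "x \<otimes>\<^bsub>H\<^esub> y = x * y" and H_one: "\<one>\<^bsub>H\<^esub> = 1" for x y
    using assms(2) by (auto simp: mult_group_def SL1_def)
  have H_nz: "x \<noteq> 0" if "x \<in> carrier H" for x
    using assms(2) that by (auto simp: mult_group_def SL1_def)
  have H_inv: "inv\<^bsub>H\<^esub> x = inverse x" if "x \<in> carrier H" for x
    using H.r_inv[OF that] by (simp add: H_mult H_one inverse_unique)
  \<comment> \<open>Both choices of \<open>H\<close> contain all commutators of nonzero elements of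
    \<open>D\<close>; from here on they are treated alike.\<close>
  have H_comm: "p * a * inverse p * inverse a \<in> carrier H" if "p \<noteq> 0" "a \<noteq> 0" for p a
    using assms(2) that D.reduced_norm_commutator[OF that] by (auto simp: mult_group_def SL1_def)
  have B_mem: "b \<in> carrier H" "b \<noteq> 0" "inverse b \<in> B" if "b \<in> B" for b
    using that H.B_carrier H_nz subgroup.m_inv_closed[OF H.subgroup_B that] H_inv by auto
  obtain U where U: "U \<lhd> H\<lparr>carrier := B\<rparr>" "nilpotent_group (H\<lparr>carrier := U\<rparr>)"
    "U \<inter> (B \<inter> N) = {\<one>\<^bsub>H\<^esub>}" "U <#>\<^bsub>H\<^esub> (B \<inter> N) = B"
    using assms(3) by (auto simp: split_BN_pair_def)
  have U_sub: "U \<subseteq> B" using normal_imp_subgroup[OF U(1)] subgroup.subset by fastforce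
  have U_conj: "b * u * inverse b \<in> U" if "b \<in> B" "u \<in> U" for b u
    using normal.inv_op_closed2[OF U(1), of b u] that B_mem
    by (simp add: H_mult H_inv H.m_inv_consistent[OF H.subgroup_B])
  have "U = {1}"
  proof (rule ccontr)
    assume "U \<noteq> {1}"
    then have "carrier (H\<lparr>carrier := U\<rparr>) \<noteq> {\<one>\<^bsub>H\<lparr>carrier := U\<rparr>\<^esub>}" by (simp add: H_one)
    from nilpotent_group_nontrivial_center[OF U(2) this]
    obtain a where a: "a \<in> U" "a \<noteq> 1" and a_comm: "\<forall>u\<in>U. u * a = a * u"
      by (auto simp: H_mult H_one)
    have a0: "a \<noteq> 0" using a U_sub B_mem(2) by blast
    have "a * x = x * a" for x
    proof (cases "finite (UNIV :: 'k set)")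
      case True
      then show ?thesis by (intro wedderburn_little D.finite_UNIV_if_finite_scalars)
    next
      case False
      obtain nr :: "'d \<Rightarrow> 'k" and n where nr: "n > 0" "\<And>x y. nr (x * y) = nr x * nr y"
        "nr 1 = 1" "nr 0 = 0" "\<And>x. \<exists>p. degree p = n \<and> (\<forall>t. poly p t = nr (x + scale t 1))"
        "\<And>x y. \<exists>p. degree p \<le> n \<and> (\<forall>t. poly p t = nr (x + scale t y))"
        by (rule D.exists_algebra_norm) blast
      have fin_conj: "finite ((\<lambda>b. b * a * inverse b) ` B)"
      proof (rule D.finite_commuting_conjugates)
        fix b b' assume b: "b \<in> B" "b' \<in> B"
        \<comment> \<open>Conjugating back by \<open>b\<close> reduces the commutation of two
          conjugates of \<open>a\<close> to that of \<open>a\<close> with the element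
          \<open>u\<close> of \<open>U\<close>.\<close>
        define c where "c = b' * a * inverse b'"
        define u where "u = inverse b * c * inverse (inverse b)"
        have "u \<in> U" unfolding u_def c_def by (intro U_conj B_mem(3) b a(1))
        then have "u * a = a * u" using a_comm by blast
        moreover have "c = b * u * inverse b"
          using B_mem(2)[OF b(1)] by (simp add: u_def mult.assoc) (simp flip: mult.assoc)
        moreover have "(b * x * inverse b) * (b * y * inverse b) = b * (x * y) * inverse b" for x y
        proof -
          have "(b * x * inverse b) * (b * y * inverse b) = b * x * (inverse b * b) * y * inverse b"
            by (simp only: mult.assoc)
          then show ?thesis using B_mem(2)[OF b(1)] by (simp add: mult.assoc)
        qed
        ultimately show "(b * a * inverse b) * (b' * a * inverse b') =
            (b' * a * inverse b') * (b * a * inverse b)"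
          unfolding c_def[symmetric] by simp
      qed (rule B_mem(2))
      obtain R where R: "finite R" "R \<subseteq> carrier H"
        "\<And>g. g \<in> carrier H \<Longrightarrow> \<exists>b1\<in>B. \<exists>r\<in>R. \<exists>b2\<in>B. g = b1 * r * b2"
        using H.finite_double_coset_representatives[OF fin] by (auto simp: H_mult)
      have R_nz: "r \<noteq> 0" if "r \<in> R" for r using that R(2) H_nz by blast
      have fin_norms: "finite ((\<lambda>g. nr (a - g * a * inverse g)) ` carrier H)"
      proof (rule finite_norms_of_double_cosets)
        show "inverse b \<in> B" if "b \<in> B" for b using that by (rule B_mem(3))
        show "\<exists>b1\<in>B. \<exists>r\<in>R. \<exists>b2\<in>B. g = b1 * r * b2" if "g \<in> carrier H" for g
          using that by (rule R(3))
      qed (rule nr(2) nr(3) R(1) fin_conj | erule B_mem(2) | erule R_nz)+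
      have "{nr (a - g * a * inverse g) | g p. p \<noteq> 0 \<and> g = p * a * inverse p * inverse a} \<subseteq>
          (\<lambda>g. nr (a - g * a * inverse g)) ` carrier H"
      proof
        fix v assume "v \<in> {nr (a - g * a * inverse g) | g p. p \<noteq> 0 \<and> g = p * a * inverse p * inverse a}"
        then obtain g p where "v = nr (a - g * a * inverse g)" "p \<noteq> 0" "g = p * a * inverse p * inverse a"
          by (elim CollectE exE conjE)
        moreover from this have "g \<in> carrier H" using H_comm a0 by metis
        ultimately show "v \<in> (\<lambda>g. nr (a - g * a * inverse g)) ` carrier H" by (intro image_eqI)
      qed
      then have "finite {nr (a - g * a * inverse g) | g p. p \<noteq> 0 \<and> g = p * a * inverse p * inverse a}"
        using fin_norms by (rule finite_subset)
      then show ?thesis by (rule D.central_if_finitely_many_norms[OF False nr a0])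
    qed
    \<comment> \<open>Being central in \<open>D\<close>, \<open>a\<close> is fixed by conjugation
      with \<open>N\<close>. Saturation puts it into \<open>B \<inter> N\<close>, which meets
      \<open>U\<close> trivially.\<close>
    then have "inv\<^bsub>H\<^esub> g \<otimes>\<^bsub>H\<^esub> a \<otimes>\<^bsub>H\<^esub> g = a" if "g \<in> carrier H" for g
      using that H_nz[OF that] by (simp add: H_mult H_inv mult.assoc) (simp flip: mult.assoc)
    then have "a \<in> B \<inter> N"
      using H.N_carrier a U_sub B_mem(1) by (intro H.saturated_core[OF sat]) auto
    then show False using a U(3) by (auto simp: H_one)
  qed
  \<comment> \<open>With \<open>U\<close> trivial, the factorization of \<open>B\<close> collapses
    to \<open>B = B \<inter> N\<close>.\<close>
  then have "B \<subseteq> N" using U(4) by (auto simp: set_mult_def H_mult)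
  then show ?thesis by (rule H.trivial_if_B_subset_N[OF sat])
qed

end
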